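(* Let $p$ be a prime, $n\ge1$, $m\ge1$, and let $G\subseteq\mathrm{GL}_n(\mathbb F_p)$ be a subgroup fixing a hyperplane $H\subset V=(\mathbb F_p)^n$ pointwise. Let $\ell=\dim_{\mathbb F_p}(\mathrm{RootSpace}(G)\cap H)$ and let $e$ be the maximal order of a semisimple element of $G$. Then $$\mathrm{Hilb}\Big(\big(S/\mathfrak m^{[p^m]}\big)^G,t\Big)=\Big(\frac{1-t^{p^m}}{1-t}\Big)^{n-\ell-1}\Big(\frac{1-t^{p^m}}{1-t^p}\Big)^{\ell}\Big(\frac{1-t^{p^m-1}}{1-t^e}+t^{p^m-1}\Big(\frac{1-t^p}{1-t}\Big)^{\ell}\Big)$$ $$=\Big(\frac{1-t^{p^m}}{1-t}\Big)^{n-\ell-1}\Big(\frac{1-t^{p^m}}{1-t^p}\Big)^{\ell}\frac{1-t^{p^m-1}}{1-t^e}+t^{p^m-1}\Big(\frac{1-t^{p^m}}{1-t}\Big)^{n-1}$$ $$=\mathrm{Hilb}(S^G,t)\,(1-t^{p^m})^{n-1}\Big((1-t^{p^m-1})+t^{p^m-1}(1-t^e)\Big(\frac{1-t^p}{1-t}\Big)^{\ell}\Big).$$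
   Context: $S=\mathbb F_p[x_1,\dots,x_n]$ is the symmetric algebra of $V^*$ (graded by degree), with $\mathrm{GL}_n(\mathbb F_p)$ acting by linear substitution; $\mathfrak m^{[p^m]}=(x_1^{p^m},\dots,x_n^{p^m})$, a $G$-stable homogeneous ideal. $\mathrm{Hilb}(M,t)=\sum_d\dim M_d\,t^d$. Root space: fix a linear form $l\in V^*$ with $\ker l=H$; each $g\in G$ determines $\alpha_g\in V$ with $g(v)=v+l(v)\alpha_g$ for all $v\in V$, and $\mathrm{RootSpace}(G)=\{\alpha_g:g\in G\}$; $\mathrm{RootSpace}(G)\cap H$ is an $\mathbb F_p$-subspace. An element is semisimple if diagonalizable; $e$ equals the index in $G$ of the normal subgroup of transvections (kernel of $\det$ on $G$), with $e=1$ if $G$ has no nontrivial semisimple element. Also $\mathrm{Hilb}(S^G,t)=1/\big((1-t^p)^{\ell}(1-t)^{n-\ell-1}(1-t^e)\big)$. *)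

theory Defs
  imports
    "HOL-Analysis.Cartesian_Space"
    "HOL-Algebra.Embedded_Algebras"
    "HOL-Algebra.QuotRing"
    "HOL-Algebra.Multiplicative_Group"
    "HOL-Computational_Algebra.Formal_Power_Series"
    "HOL-Library.Poly_Mapping"
    "Berlekamp_Zassenhaus.Finite_Field"
begin

section \<open>Matrix groups\<close>

definition GL :: "('k::field ^ 'n ^ 'n) monoid" where
  "GL = \<lparr>carrier = {A. invertible A}, monoid.mult = (**), one = mat 1\<rparr>"

lemma group_GL: "group (GL :: ('k::field ^ 'n ^ 'n) monoid)"
proof (rule groupI)
  fix A :: "'k ^ 'n ^ 'n"
  assume "A \<in> carrier GL"
  then obtain B where "A ** B = mat 1" "B ** A = mat 1"
    by (auto simp: GL_def invertible_def)
  then show "\<exists>B \<in> carrier GL. B \<otimes>\<^bsub>GL\<^esub> A = \<one>\<^bsub>GL\<^esub>"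
    by (auto simp: GL_def invertible_def intro!: bexI[of _ B])
next
  have "invertible (mat 1 :: 'k ^ 'n ^ 'n)"
    unfolding invertible_def by (rule exI[of _ "mat 1"]) simp
  then show "\<one>\<^bsub>GL\<^esub> \<in> carrier (GL :: ('k ^ 'n ^ 'n) monoid)"
    by (simp add: GL_def)
qed (auto simp: GL_def invertible_mult matrix_mul_assoc)

text \<open>Semisimple means diagonalizable over the ground field.\<close>

definition semisimple :: "'k::field ^ 'n ^ 'n \<Rightarrow> bool" where
  "semisimple A \<longleftrightarrow>
    (\<exists>P D :: 'k ^ 'n ^ 'n. invertible P \<and> (\<forall>i j. i \<noteq> j \<longrightarrow> D $ i $ j = 0) \<and> A = P ** D ** matrix_inv P)"

definition max_semisimple_order :: "('k::field ^ 'n ^ 'n) set \<Rightarrow> nat" where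
  "max_semisimple_order G = Max {group.ord GL g |g. g \<in> G \<and> semisimple g}"

definition root_space :: "('k::field ^ 'n \<Rightarrow> 'k) \<Rightarrow> ('k ^ 'n ^ 'n) set \<Rightarrow> ('k ^ 'n) set" where
  "root_space l G = {\<alpha>. \<exists>g \<in> G. \<forall>v. g *v v = v + l v *s \<alpha>}"


section \<open>The polynomial ring and its group action\<close>

text \<open>
  The ring $S = k[x_i : i \in I]$ over the finite index type $I$: a polynomial maps the exponent
  vectors of its monomials to their coefficients.
\<close>

type_synonym ('n, 'k) mpol = "('n \<Rightarrow>\<^sub>0 nat) \<Rightarrow>\<^sub>0 'k"

definition Const :: "'k::comm_ring_1 \<Rightarrow> ('n, 'k) mpol" where
  "Const c = Poly_Mapping.single 0 c"

definition Var :: "'n \<Rightarrow> ('n, 'k::comm_ring_1) mpol" where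
  "Var i = Poly_Mapping.single (Poly_Mapping.single i 1) 1"

definition subst :: "('n \<Rightarrow> ('n, 'k) mpol) \<Rightarrow> ('n::finite, 'k::comm_ring_1) mpol \<Rightarrow> ('n, 'k) mpol" where
  "subst \<phi> f = (\<Sum>a \<in> Poly_Mapping.keys f.
     Const (Poly_Mapping.lookup f a) * (\<Prod>i \<in> UNIV. \<phi> i ^ Poly_Mapping.lookup a i))"

text \<open>
  The variables are the coordinate functions on $V$, so that $S$ is the symmetric algebra of the
  dual space, on which $g$ acts by $x \mapsto x \circ g^{-1}$.
\<close>

definition act :: "'k::field ^ 'n ^ 'n \<Rightarrow> ('n::finite, 'k) mpol \<Rightarrow> ('n, 'k) mpol" where
  "act g f = subst (\<lambda>i. \<Sum>j \<in> UNIV. Const (matrix_inv g $ i $ j) * Var j) f"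

definition homogeneous :: "nat \<Rightarrow> ('n::finite, 'k::comm_ring_1) mpol set" where
  "homogeneous d = {f. \<forall>a \<in> Poly_Mapping.keys f. (\<Sum>i \<in> UNIV. Poly_Mapping.lookup a i) = d}"

definition invariants :: "('k::field ^ 'n ^ 'n) set \<Rightarrow> ('n::finite, 'k) mpol set" where
  "invariants G = {f. \<forall>g \<in> G. act g f = f}"


section \<open>Quotient rings and Hilbert series\<close>

definition mpol_ring :: "('n, 'k::comm_ring_1) mpol ring" where
  "mpol_ring = \<lparr>carrier = UNIV, monoid.mult = (*), one = 1, zero = 0, add = (+)\<rparr>"

lemma cring_mpol_ring: "cring (mpol_ring :: ('n, 'k::comm_ring_1) mpol ring)"
proof (rule cringI)
  show "abelian_group (mpol_ring :: ('n, 'k) mpol ring)"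
  proof (rule abelian_groupI)
    fix x :: "('n, 'k) mpol"
    show "\<exists>y \<in> carrier mpol_ring. y \<oplus>\<^bsub>mpol_ring\<^esub> x = \<zero>\<^bsub>mpol_ring\<^esub>"
      by (auto simp: mpol_ring_def intro!: exI[of _ "- x"])
  qed (auto simp: mpol_ring_def ac_simps)
  show "comm_monoid (mpol_ring :: ('n, 'k) mpol ring)"
    by (rule comm_monoidI) (auto simp: mpol_ring_def ac_simps)
qed (auto simp: mpol_ring_def algebra_simps)

definition power_ideal :: "nat \<Rightarrow> ('n, 'k::comm_ring_1) mpol set" where
  "power_ideal q = Idl\<^bsub>mpol_ring\<^esub> (range (\<lambda>i. Var i ^ q))"

text \<open>
  Elements of the quotient by an ideal $I$ are cosets. If $I$ is stable under $g$, then the induced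
  action of $g$ sends the coset of $f$ to its image under $f \mapsto g f$, which is the coset of
  $g f$.
\<close>

definition quot_invariants ::
    "('k::field ^ 'n ^ 'n) set \<Rightarrow> ('n::finite, 'k) mpol set \<Rightarrow> ('n, 'k) mpol set set" where
  "quot_invariants G I = {X \<in> carrier (mpol_ring Quot I). \<forall>g \<in> G. act g ` X = X}"

definition quot_homogeneous ::
    "('n::finite, 'k::comm_ring_1) mpol set \<Rightarrow> nat \<Rightarrow> ('n, 'k) mpol set set" where
  "quot_homogeneous I d = (\<lambda>f. I +>\<^bsub>mpol_ring\<^esub> f) ` homogeneous d"

text \<open>
  Hilbert series of a graded subspace of a ring \<open>R\<close> over a field \<open>K\<close> contained in \<open>R\<close>;
  \<open>M d\<close> is the component of degree \<open>d\<close>.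
\<close>

definition hilbert_series :: "'a ring \<Rightarrow> 'a set \<Rightarrow> (nat \<Rightarrow> 'a set) \<Rightarrow> rat fps" where
  "hilbert_series R K M = Abs_fps (\<lambda>d. of_nat (ring.dim R K (M d)))"

definition Hilb_invariants :: "('k::field ^ 'n ^ 'n::finite) set \<Rightarrow> rat fps" where
  "Hilb_invariants G = hilbert_series mpol_ring (range Const)
     (\<lambda>d. invariants G \<inter> homogeneous d)"

definition Hilb_quot_invariants ::
    "('k::field ^ 'n ^ 'n) set \<Rightarrow> ('n::finite, 'k) mpol set \<Rightarrow> rat fps" where
  "Hilb_quot_invariants G I = hilbert_series (mpol_ring Quot I)
     (range (\<lambda>c. I +>\<^bsub>mpol_ring\<^esub> Const c))
     (\<lambda>d. quot_invariants G I \<inter> quot_homogeneous I d)"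

end

theory Submission
  imports Defs
begin

text \<open>
  In suitable coordinates $G$ consists of the substitutions $x_i \mapsto x_i + c_i z$ ($i \in L$,
  $|L| = \ell$, $c_i$ arbitrary), $z \mapsto \zeta z$ with $\zeta^e = 1$, all other variables being fixed;
  here $z = l$ and $L$ indexes a basis of the part of the root space in $H$. Write a class modulo
  $x_i^q, z^q$ with $q = p^m$ as $\sum_{j<q} z^j f_j$. If it is invariant and $z^j f_j$ with
  $j < q - 1$ is its lowest term, comparing coefficients of $z^{j+1}$ shows
  $\partial f_j / \partial x_i = 0$ for $i \in L$, so $f_j$ is a polynomial in the $x_i^p$ and the
  fixed variables, and $e$ divides $j$. Replacing $x_i^p$ by the invariant $x_i^p - x_i z^{p-1}$
  realises every such lowest term, while $z^{q-1} f$ is invariant for all $f$. Hence the dimension in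
  each degree is the number of monomials that can occur in a lowest term. The series of $S^G$ is the
  limit $m \to \infty$, since the ideal vanishes in degrees below $p^m$.
\<close>

text \<open>The ground field is finite, so a dimension N is recognised from a cardinality p^N, and
  only cardinalities are carried along the projection to the quotient and along the change of
  coordinates. The normal form rests on the composition law of roots: \<open>h\<close> with root
  \<beta> followed by \<open>g\<close> with root \<alpha> has root \<beta> + (1 + l(\<beta>))
  \<alpha>. Hence 1 + l is multiplicative, with a cyclic group of values whose order turns out to be
  e; and on the roots in H the law is plain addition, which gives a subspace because the scalars
  form the prime field. The exponent q - 1 of z is exceptional because the condition that a lowest
  term would have to satisfy sits at z^q, inside the ideal; these terms produce the second summand
  of the series. The lifts of lowest terms are not monomials, but their further terms have higher
  degree in z, so the system they form is unitriangular and both bounds on the number of classes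
  agree.\<close>

section \<open>Constants and monomials\<close>

lemma Const_add: "Const (a + b) = Const a + Const b"
  by (simp add: Const_def single_add)

lemma Const_mult: "Const (a * b) = Const a * Const b"
  by (simp add: Const_def mult_single)

lemma Const_0 [simp]: "Const 0 = 0"
  and Const_1 [simp]: "Const 1 = 1"
  by (simp_all add: Const_def)

lemma Const_diff: "Const (a - b) = Const a - Const b"
  by (simp add: Const_def single_diff)

lemma Const_uminus: "Const (- a) = - Const a"
  by (simp add: Const_def single_uminus)

lemma Const_sum: "Const (sum f A) = (\<Sum>x\<in>A. Const (f x))"
  by (induction A rule: infinite_finite_induct) (simp_all add: Const_add)

lemma Const_power: "Const (a ^ k) = Const a ^ k"
  by (induction k) (simp_all add: Const_mult)

lemma lookup_Const_mult:
  "Poly_Mapping.lookup (Const c * f) a = c * Poly_Mapping.lookup f a"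
proof -
  have "Const c * f = Poly_Mapping.map ((*) c) f"
    by (simp add: Const_def mult_map_scale_conv_mult)
  then show ?thesis
    by (simp add: Poly_Mapping.map.rep_eq when_def)
qed

lemma Var_power: "Var i ^ k = Poly_Mapping.single (Poly_Mapping.single i k) 1"
  by (induction k) (simp_all add: Var_def mult_single flip: single_add)

lemma prod_single:
  "(\<Prod>i\<in>A. Poly_Mapping.single (a i) (1::'k::comm_ring_1)) = Poly_Mapping.single (\<Sum>i\<in>A. a i :: 'n \<Rightarrow>\<^sub>0 nat) 1"
  by (induction A rule: infinite_finite_induct) (simp_all add: mult_single)

lemma poly_mapping_sum_singles:
  fixes a :: "'n::finite \<Rightarrow>\<^sub>0 'b::comm_monoid_add"
  shows "(\<Sum>i\<in>UNIV. Poly_Mapping.single i (Poly_Mapping.lookup a i)) = a"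
  by (rule poly_mapping_eqI) (simp add: lookup_sum lookup_single when_def)

lemma single_eq_monomial:
  "Poly_Mapping.single a c = Const c * (\<Prod>i\<in>UNIV. Var i ^ Poly_Mapping.lookup a i)"
  for a :: "'n::finite \<Rightarrow>\<^sub>0 nat"
  by (simp add: Var_power prod_single poly_mapping_sum_singles Const_def mult_single)

lemma mpol_sum_monomials:
  "f = (\<Sum>a\<in>Poly_Mapping.keys f. Poly_Mapping.single a (Poly_Mapping.lookup f a))"
  by (rule poly_mapping_eqI) (auto simp: lookup_sum lookup_single when_def in_keys_iff)

lemma mpol_induct [case_names zero single add]:
  fixes f :: "('n, 'k::comm_ring_1) mpol"
  assumes "P 0" "\<And>a c. P (Poly_Mapping.single a c)" "\<And>f g. P f \<Longrightarrow> P g \<Longrightarrow> P (f + g)"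
  shows "P f"
proof -
  have "P (\<Sum>a\<in>A. Poly_Mapping.single a (Poly_Mapping.lookup f a))" for A
    by (induction A rule: infinite_finite_induct) (auto intro: assms)
  then show ?thesis
    by (subst mpol_sum_monomials)
qed

section \<open>Substitution\<close>

lemma subst_superset:
  assumes "finite A" "Poly_Mapping.keys f \<subseteq> A"
  shows "subst \<phi> f = (\<Sum>a\<in>A. Const (Poly_Mapping.lookup f a) * (\<Prod>i\<in>UNIV. \<phi> i ^ Poly_Mapping.lookup a i))"
  unfolding subst_def
  by (rule sum.mono_neutral_left) (use assms in \<open>auto simp: in_keys_iff\<close>)

lemma subst_single:
  "subst \<phi> (Poly_Mapping.single a c) = Const c * (\<Prod>i\<in>UNIV. \<phi> i ^ Poly_Mapping.lookup a i)"
  by (subst subst_superset[of "{a}"]) auto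

lemma subst_0 [simp]: "subst \<phi> 0 = 0"
  by (simp add: subst_def)

lemma subst_Const [simp]: "subst \<phi> (Const c) = Const c"
  by (simp add: Const_def subst_single)

lemma subst_1 [simp]: "subst \<phi> 1 = 1"
  using subst_Const[of \<phi> 1] by simp

lemma subst_add: "subst \<phi> (f + g) = subst \<phi> f + subst \<phi> g"
proof -
  let ?A = "Poly_Mapping.keys f \<union> Poly_Mapping.keys g"
  have "Poly_Mapping.keys (f + g) \<subseteq> ?A"
    by (rule keys_add)
  then show ?thesis
    by (simp add: subst_superset[of ?A] lookup_add Const_add sum.distrib algebra_simps)
qed

lemma subst_uminus: "subst \<phi> (- f) = - subst \<phi> f"
  using subst_add[of \<phi> f "- f"] by (simp add: eq_neg_iff_add_eq_0 add.commute)

lemma subst_diff: "subst \<phi> (f - g) = subst \<phi> f - subst \<phi> g"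
  using subst_add[of \<phi> f "- g"] by (simp add: subst_uminus)

lemma subst_mult: "subst \<phi> (f * g) = subst \<phi> f * subst \<phi> g"
proof (induction f rule: mpol_induct)
  case (single a c)
  show ?case
    by (induction g rule: mpol_induct)
      (simp_all add: subst_add subst_single mult_single lookup_add power_add prod.distrib
         Const_mult algebra_simps)
qed (simp_all add: subst_add algebra_simps)

lemma subst_power: "subst \<phi> (f ^ k) = subst \<phi> f ^ k"
  by (induction k) (simp_all add: subst_mult)

lemma subst_sum: "subst \<phi> (sum f A) = (\<Sum>x\<in>A. subst \<phi> (f x))"
  by (induction A rule: infinite_finite_induct) (simp_all add: subst_add)

lemma subst_prod: "subst \<phi> (prod f A) = (\<Prod>x\<in>A. subst \<phi> (f x))"
  by (induction A rule: infinite_finite_induct) (simp_all add: subst_mult)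

lemma subst_Var [simp]: "subst \<phi> (Var i) = \<phi> i"
proof -
  have "(\<Prod>j\<in>UNIV. \<phi> j ^ Poly_Mapping.lookup (Poly_Mapping.single i 1) j) =
        (\<Prod>j\<in>UNIV. if j = i then \<phi> j else 1)"
    by (rule prod.cong) (auto simp: lookup_single when_def)
  then show ?thesis
    by (simp add: Var_def subst_single)
qed

lemma subst_subst: "subst \<phi> (subst \<psi> f) = subst (\<lambda>i. subst \<phi> (\<psi> i)) f"
  by (simp add: subst_def[of \<psi>] subst_def[of "\<lambda>i. subst \<phi> (\<psi> i)"] subst_sum subst_mult
      subst_prod subst_power)

lemma subst_id: "subst Var f = f"
  by (subst (2) mpol_sum_monomials) (simp add: subst_def single_eq_monomial)

section \<open>Linear substitutions\<close>

text \<open>The substitution in \<open>act\<close> without the inverse. It reverses matrix products,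
  which is why \<open>act\<close> is a left action; for a group, both run through the same set of
  substitutions.\<close>

definition linear_subst :: "'k::comm_ring_1 ^ 'n ^ 'n \<Rightarrow> ('n::finite, 'k) mpol \<Rightarrow> ('n, 'k) mpol" where
  "linear_subst A = subst (\<lambda>i. \<Sum>j\<in>UNIV. Const (A $ i $ j) * Var j)"

lemma act_eq_linear_subst: "act g = linear_subst (matrix_inv g)"
  by (simp add: fun_eq_iff act_def linear_subst_def)

lemma linear_subst_matrix_mul: "linear_subst A (linear_subst B f) = linear_subst (B ** A) f"
proof -
  have "(\<Sum>j\<in>UNIV. Const (B $ i $ j) * (\<Sum>k\<in>UNIV. Const (A $ j $ k) * Var k)) =
        (\<Sum>j\<in>UNIV. Const ((B ** A) $ i $ j) * Var j)" for i
    by (simp add: matrix_matrix_mult_def Const_sum Const_mult sum_distrib_left sum_distrib_right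
        mult.assoc) (rule sum.swap)
  then show ?thesis
    by (simp add: linear_subst_def subst_subst subst_sum subst_mult)
qed

lemma linear_subst_mat_1 [simp]: "linear_subst (mat 1) f = f"
proof -
  have "(\<Sum>j\<in>UNIV. Const ((mat 1 :: 'b ^ 'a ^ 'a) $ i $ j) * Var j) = Var i" for i
    by (simp add: mat_def if_distrib[of Const] if_distrib[of "\<lambda>x. x * _"] cong: if_cong)
  then show ?thesis
    by (simp add: linear_subst_def subst_id)
qed

lemma matrix_inv_mult:
  assumes "invertible A"
  shows matrix_inv_mult_right: "A ** matrix_inv A = mat 1"
    and matrix_inv_mult_left: "matrix_inv A ** A = mat 1"
  using someI_ex[OF assms[unfolded invertible_def]] by (auto simp: matrix_inv_def)

lemma linear_subst_inverse:
  assumes "invertible A"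
  shows "linear_subst A (linear_subst (matrix_inv A) f) = f"
    and "linear_subst (matrix_inv A) (linear_subst A f) = f"
  using assms by (simp_all add: linear_subst_matrix_mul matrix_inv_mult)

section \<open>Homogeneous components\<close>

lemma homogeneous_0: "0 \<in> homogeneous d"
  by (simp add: homogeneous_def)

lemma homogeneous_add: "f \<in> homogeneous d \<Longrightarrow> g \<in> homogeneous d \<Longrightarrow> f + g \<in> homogeneous d"
  unfolding homogeneous_def using keys_add[of f g] by blast

lemma homogeneous_diff: "f \<in> homogeneous d \<Longrightarrow> g \<in> homogeneous d \<Longrightarrow> f - g \<in> homogeneous d"
  unfolding homogeneous_def using keys_add[of f "- g"] by auto

lemma homogeneous_sum: "(\<And>x. x \<in> A \<Longrightarrow> f x \<in> homogeneous d) \<Longrightarrow> sum f A \<in> homogeneous d"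
  by (induction A rule: infinite_finite_induct) (auto simp: homogeneous_0 homogeneous_add)

lemma homogeneous_mult:
  assumes "f \<in> homogeneous d" "g \<in> homogeneous e"
  shows "f * g \<in> homogeneous (d + e)"
  using assms keys_mult[of f g] unfolding homogeneous_def
  by (fastforce simp: lookup_add sum.distrib)

lemma homogeneous_Const: "Const c \<in> homogeneous 0"
  by (simp add: homogeneous_def Const_def)

lemma homogeneous_Var: "Var i \<in> homogeneous 1"
  by (simp add: homogeneous_def Var_def lookup_single when_def)

lemma homogeneous_Const_mult: "f \<in> homogeneous d \<Longrightarrow> Const c * f \<in> homogeneous d"
  using homogeneous_mult[OF homogeneous_Const, of f d c] by simp

lemma homogeneous_power: "f \<in> homogeneous d \<Longrightarrow> f ^ k \<in> homogeneous (k * d)"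
  by (induction k) (use homogeneous_Const[of 1] in \<open>auto simp: homogeneous_mult\<close>)

lemma homogeneous_prod:
  "(\<And>x. x \<in> A \<Longrightarrow> f x \<in> homogeneous (d x)) \<Longrightarrow> prod f A \<in> homogeneous (sum d A)"
  by (induction A rule: infinite_finite_induct)
    (use homogeneous_Const[of 1] in \<open>auto simp: homogeneous_mult\<close>)

lemma homogeneous_linear_subst:
  assumes "f \<in> homogeneous d"
  shows "linear_subst A f \<in> homogeneous d"
  unfolding linear_subst_def subst_def
proof (rule homogeneous_sum, rule homogeneous_Const_mult)
  fix a assume "a \<in> Poly_Mapping.keys f"
  then have d: "d = (\<Sum>i\<in>UNIV. Poly_Mapping.lookup a i * 1)"
    using assms by (simp add: homogeneous_def)
  show "(\<Prod>i\<in>UNIV. (\<Sum>j\<in>UNIV. Const (A $ i $ j) * Var j) ^ Poly_Mapping.lookup a i) \<in> homogeneous d"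
    unfolding d
    by (intro homogeneous_prod homogeneous_power homogeneous_sum homogeneous_Const_mult homogeneous_Var)
qed

section \<open>Dimension by counting\<close>

lemma (in ring) card_dimension:
  assumes K: "subfield K R" and "dimension n K E" and "finite K"
  shows "card E = card K ^ n"
proof -
  obtain Vs where Vs: "set Vs \<subseteq> carrier R" "independent K Vs" "length Vs = n" "Span K Vs = E"
    using exists_base[OF K assms(2)] by blast
  have E: "E = (\<lambda>Ks. combine Ks Vs) ` {Ks. set Ks \<subseteq> K \<and> length Ks = n}"
    using Span_eq_combine_set_length_version[OF K Vs(1)] Vs(3,4) by auto
  have "inj_on (\<lambda>Ks. combine Ks Vs) {Ks. set Ks \<subseteq> K \<and> length Ks = n}"
  proof (rule inj_onI)
    fix xs ys
    assume "xs \<in> {Ks. set Ks \<subseteq> K \<and> length Ks = n}" "ys \<in> {Ks. set Ks \<subseteq> K \<and> length Ks = n}"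
      and "combine xs Vs = combine ys Vs"
    moreover from this have "combine xs Vs \<in> Span K Vs"
      using E Vs(4) by blast
    ultimately show "xs = ys"
      using unique_decomposition[OF K Vs(2), of "combine xs Vs"] Vs(3) by auto
  qed
  then have "card E = card {Ks. set Ks \<subseteq> K \<and> length Ks = n}"
    unfolding E by (rule card_image)
  then show ?thesis
    using assms(3) by (simp add: card_lists_length_eq)
qed

text \<open>A finite \<open>E\<close> is spanned by the list of its own elements and so has some
  dimension \<open>d\<close>; then \<open>card K ^ d = card K ^ n\<close> forces
  \<open>d = n\<close> because a field has at least two elements. Thus counting replaces the choice
  of a basis.\<close>

lemma (in ring) dim_eq_if_card:
  assumes K: "subfield K R" and E: "subalgebra K E R" and "finite K" and "card E = card K ^ n"
  shows "dim K E = n"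
proof -
  have "{\<zero>, \<one>} \<subseteq> K" "\<zero> \<noteq> \<one>"
    using subfieldE(3,6)[OF K] subringE(2,3)[OF subfieldE(1)[OF K]] by auto
  then have K1: "1 < card K"
    using card_mono[of K "{\<zero>, \<one>}"] assms(3) by simp
  \<comment> \<open>A nonzero \<open>card\<close> certifies that \<open>E\<close> is finite.\<close>
  then have "0 < card E"
    unfolding assms(4) by simp
  then obtain Us where Us: "set Us = E"
    using finite_list[OF card_ge_0_finite] by blast
  have "Span K Us = E"
    using subalgebra_Span_incl[OF K E] Span_base_incl[OF K] subalgebra_in_carrier[OF E] Us by blast
  then obtain d where d: "dimension d K E"
    using Span_finite_dimension[OF K, of Us] subalgebra_in_carrier[OF E] Us by auto
  have "d = n"
    using card_dimension[OF K d assms(3)] assms(4) K1 by simp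
  then show ?thesis
    using dimI[OF K d] by (simp add: over_def)
qed

section \<open>The Frobenius power of the maximal ideal\<close>

interpretation mpol: cring "mpol_ring :: ('n, 'k::comm_ring_1) mpol ring"
  by (rule cring_mpol_ring)

lemma mpol_ring_simps [simp]:
  "carrier mpol_ring = UNIV" "x \<otimes>\<^bsub>mpol_ring\<^esub> y = x * y" "x \<oplus>\<^bsub>mpol_ring\<^esub> y = x + y"
  "\<zero>\<^bsub>mpol_ring\<^esub> = 0" "\<one>\<^bsub>mpol_ring\<^esub> = 1"
  by (simp_all add: mpol_ring_def)

lemma mpol_ring_uminus [simp]: "\<ominus>\<^bsub>mpol_ring\<^esub> x = - x"
  by (rule mpol.minus_equality) auto

lemma mpol_ring_minus [simp]: "x \<ominus>\<^bsub>mpol_ring\<^esub> y = x - y"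
  by (simp add: a_minus_def)

lemma mpol_subgroupI:
  assumes "0 \<in> A" "\<And>x y. x \<in> A \<Longrightarrow> y \<in> A \<Longrightarrow> x - y \<in> A"
  shows "subgroup A (add_monoid mpol_ring)"
proof -
  have "- x \<in> A" if "x \<in> A" for x
    using assms(2)[OF assms(1) that] by simp
  moreover from this have "x + y \<in> A" if "x \<in> A" "y \<in> A" for x y
    using assms(2)[of x "- y"] that by simp
  ultimately show ?thesis
    using assms(1) by (intro mpol.add.subgroupI) (auto simp flip: a_inv_def)
qed

text \<open>The ideal is monomial. The set \<open>J\<close> of the right-hand side is an ideal
  containing the generators, and conversely each monomial allowed in \<open>J\<close> is a multiple
  of some \<open>Var i ^ q\<close>. Membership thus becomes a test on exponent vectors.\<close>

lemma mem_power_ideal_iff: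
  fixes f :: "('n::finite, 'k::comm_ring_1) mpol"
  shows "f \<in> power_ideal q \<longleftrightarrow>
    (\<forall>a \<in> Poly_Mapping.keys f. \<exists>i. q \<le> Poly_Mapping.lookup a i)"
proof -
  define J :: "('n, 'k) mpol set" where
    "J = {f. \<forall>a \<in> Poly_Mapping.keys f. \<exists>i. q \<le> Poly_Mapping.lookup a i}"
  have mult: "g * f \<in> J" if fJ: "f \<in> J" for f g
    unfolding J_def
  proof (rule CollectI, rule ballI)
    fix a assume "a \<in> Poly_Mapping.keys (g * f)"
    then obtain b c where "a = b + c" "c \<in> Poly_Mapping.keys f"
      using keys_mult[of g f] by blast
    moreover from this obtain i where "q \<le> Poly_Mapping.lookup c i"
      using fJ by (auto simp: J_def)
    ultimately show "\<exists>i. q \<le> Poly_Mapping.lookup a i"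
      by (auto simp: lookup_add intro: trans_le_add2)
  qed
  have "ideal J mpol_ring"
  proof (rule idealI)
    show "ring (mpol_ring :: ('n, 'k) mpol ring)"
      by (rule mpol.ring_axioms)
    show "subgroup J (add_monoid mpol_ring)"
    proof (rule mpol_subgroupI)
      show "f - g \<in> J" if "f \<in> J" "g \<in> J" for f g
        using that keys_diff[of f g] by (auto simp: J_def)
    qed (simp add: J_def)
    show "x \<otimes>\<^bsub>mpol_ring\<^esub> a \<in> J" "a \<otimes>\<^bsub>mpol_ring\<^esub> x \<in> J" if "a \<in> J" for a x
      using mult[OF that, of x] by (simp_all add: mult.commute)
  qed
  moreover have "range (\<lambda>i. Var i ^ q) \<subseteq> J"
    by (auto simp: J_def Var_power) (metis lookup_single_eq order_refl)
  ultimately have 1: "power_ideal q \<subseteq> J"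
    unfolding power_ideal_def by (rule mpol.genideal_minimal)
  interpret I: ideal "power_ideal q :: ('n, 'k) mpol set" mpol_ring
    unfolding power_ideal_def by (rule mpol.genideal_ideal) simp
  have Var: "Var i ^ q \<in> (power_ideal q :: ('n, 'k) mpol set)" for i
    using mpol.genideal_self[of "range (\<lambda>i. Var i ^ q)"] unfolding power_ideal_def by auto
  have single: "Poly_Mapping.single a c \<in> (power_ideal q :: ('n, 'k) mpol set)"
    if "q \<le> Poly_Mapping.lookup a i" for a i c
  proof -
    have "a = (a - Poly_Mapping.single i q) + Poly_Mapping.single i q"
      using that by (intro poly_mapping_eqI) (auto simp: lookup_add lookup_minus lookup_single when_def)
    then have "Poly_Mapping.single a c = Poly_Mapping.single (a - Poly_Mapping.single i q) c * Var i ^ q"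
      by (simp add: Var_power mult_single)
    then show ?thesis
      using I.I_l_closed[OF Var] by simp
  qed
  have "f \<in> power_ideal q" if "f \<in> J" for f :: "('n, 'k) mpol"
  proof -
    have "(\<Sum>a\<in>A. Poly_Mapping.single a (Poly_Mapping.lookup f a)) \<in> power_ideal q"
      if "A \<subseteq> Poly_Mapping.keys f" for A
      using finite_subset[OF that finite_keys] that
    proof (induction A rule: finite_induct)
      case empty
      show ?case
        using I.zero_closed by simp
    next
      case (insert a A)
      with \<open>f \<in> J\<close> have "Poly_Mapping.single a (Poly_Mapping.lookup f a) \<in> power_ideal q"
        by (auto simp: J_def intro: single)
      then show ?case
        using insert I.a_closed by simp
    qed
    then show ?thesis
      by (subst mpol_sum_monomials) simp
  qed
  with 1 show ?thesis
    unfolding J_def by blast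
qed

lemma ideal_power_ideal: "ideal (power_ideal q :: ('n, 'k::comm_ring_1) mpol set) mpol_ring"
  unfolding power_ideal_def by (rule mpol.genideal_ideal) simp

lemma
  fixes f g :: "('n, 'k::comm_ring_1) mpol"
  shows power_ideal_0: "0 \<in> (power_ideal q :: ('n, 'k) mpol set)"
    and power_ideal_add: "f \<in> power_ideal q \<Longrightarrow> g \<in> power_ideal q \<Longrightarrow> f + g \<in> power_ideal q"
    and power_ideal_diff: "f \<in> power_ideal q \<Longrightarrow> g \<in> power_ideal q \<Longrightarrow> f - g \<in> power_ideal q"
    and power_ideal_mult: "f \<in> power_ideal q \<Longrightarrow> g * f \<in> power_ideal q"
    and Var_power_in_power_ideal: "Var i ^ q \<in> (power_ideal q :: ('n, 'k) mpol set)"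
proof -
  interpret I: ideal "power_ideal q :: ('n, 'k) mpol set" mpol_ring
    by (rule ideal_power_ideal)
  show "0 \<in> (power_ideal q :: ('n, 'k) mpol set)"
    using I.zero_closed by simp
  show "f + g \<in> power_ideal q" if "f \<in> power_ideal q" "g \<in> power_ideal q"
    using I.a_closed[OF that] by simp
  show "f - g \<in> power_ideal q" if "f \<in> power_ideal q" "g \<in> power_ideal q"
    using I.a_closed[OF that(1) I.a_inv_closed[OF that(2)]] by simp
  show "g * f \<in> power_ideal q" if "f \<in> power_ideal q"
    using I.I_l_closed[OF that, of g] by simp
  show "Var i ^ q \<in> (power_ideal q :: ('n, 'k) mpol set)"
    using mpol.genideal_self[of "range (\<lambda>i. Var i ^ q)"] unfolding power_ideal_def by auto
qed

lemma power_ideal_sum: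
  "(\<And>x. x \<in> A \<Longrightarrow> f x \<in> power_ideal q) \<Longrightarrow> sum f A \<in> power_ideal q"
  by (induction A rule: infinite_finite_induct) (auto simp: power_ideal_0 power_ideal_add)

lemma power_ideal_dvd: "f \<in> power_ideal q \<Longrightarrow> f dvd g \<Longrightarrow> g \<in> power_ideal q"
  by (metis dvd_def mult.commute power_ideal_mult)

lemma homogeneous_power_ideal_eq_0:
  fixes f :: "('n::finite, 'k::comm_ring_1) mpol"
  assumes "f \<in> power_ideal q" "f \<in> homogeneous d" "d < q"
  shows "f = 0"
proof (rule ccontr)
  assume "f \<noteq> 0"
  then obtain a where a: "a \<in> Poly_Mapping.keys f"
    by (metis all_not_in_conv keys_eq_empty)
  then obtain i where "q \<le> Poly_Mapping.lookup a i"
    using assms(1) by (auto simp: mem_power_ideal_iff)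
  also have "\<dots> \<le> (\<Sum>i\<in>UNIV. Poly_Mapping.lookup a i)"
    by (rule member_le_sum) auto
  also have "\<dots> = d"
    using a assms(2) by (auto simp: homogeneous_def)
  finally show False
    using assms(3) by simp
qed

section \<open>Stability of the ideal in characteristic p\<close>

lemma CHAR_mpol: "CHAR(('n, 'k::comm_ring_1) mpol) = CHAR('k)"
proof -
  have "of_nat c = (0 :: ('n, 'k) mpol) \<longleftrightarrow> of_nat c = (0 :: 'k)" for c
  proof -
    have "of_nat c = (Const (of_nat c) :: ('n, 'k) mpol)"
      by (simp add: Const_def)
    moreover have "Const x = (0 :: ('n, 'k) mpol) \<longleftrightarrow> x = 0" for x
      by (metis Const_0 Const_def lookup_single_eq lookup_zero)
    ultimately show ?thesis
      by simp
  qed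
  then show ?thesis
    by (intro CHAR_eqI) (simp_all add: of_nat_eq_0_iff_char_dvd)
qed

text \<open>Raising to the power \<open>q\<close> is additive in characteristic p when
  \<open>q\<close> is a power of p, so the \<open>q\<close>-th power of any linear form is a
  combination of the generators \<open>Var j ^ q\<close>.\<close>

lemma linear_subst_power_ideal:
  fixes f :: "('n::finite, 'k::comm_ring_1) mpol"
  assumes "prime CHAR('k)" and f: "f \<in> power_ideal (CHAR('k) ^ m)"
  shows "linear_subst A f \<in> power_ideal (CHAR('k) ^ m)"
  unfolding linear_subst_def subst_def
proof (rule power_ideal_sum)
  let ?q = "CHAR('k) ^ m"
  fix a assume "a \<in> Poly_Mapping.keys f"
  then obtain i where i: "?q \<le> Poly_Mapping.lookup a i"
    using f by (auto simp: mem_power_ideal_iff)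
  let ?y = "\<lambda>i. \<Sum>j\<in>UNIV. Const (A $ i $ j) * Var j :: ('n, 'k) mpol"
  have "?y i ^ ?q = (\<Sum>j\<in>UNIV. (Const (A $ i $ j) * Var j) ^ ?q)"
    by (rule freshmans_dream_sum') (use assms(1) in \<open>simp_all add: CHAR_mpol\<close>)
  also have "\<dots> = (\<Sum>j\<in>UNIV. Const (A $ i $ j) ^ ?q * Var j ^ ?q)"
    by (simp add: power_mult_distrib)
  also have "\<dots> \<in> power_ideal ?q"
    by (intro power_ideal_sum power_ideal_mult Var_power_in_power_ideal)
  finally have "?y i ^ ?q \<in> power_ideal ?q" .
  moreover have "?y i ^ ?q dvd ?y i ^ Poly_Mapping.lookup a i"
    using i by (rule le_imp_power_dvd)
  moreover have "\<dots> dvd (\<Prod>i\<in>UNIV. ?y i ^ Poly_Mapping.lookup a i)"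
    by (rule dvd_prodI) auto
  ultimately have "(\<Prod>i\<in>UNIV. ?y i ^ Poly_Mapping.lookup a i) \<in> power_ideal ?q"
    using power_ideal_dvd by blast
  then show "Const (Poly_Mapping.lookup f a) * (\<Prod>i\<in>UNIV. ?y i ^ Poly_Mapping.lookup a i) \<in> power_ideal ?q"
    by (rule power_ideal_mult)
qed

section \<open>Cosets and the induced action\<close>

lemma mem_coset_iff:
  "g \<in> power_ideal q +>\<^bsub>mpol_ring\<^esub> f \<longleftrightarrow> g - f \<in> power_ideal q"
  by (auto simp: a_r_coset_def r_coset_def intro: bexI[of _ "g - f"])

lemma coset_eq_iff:
  "power_ideal q +>\<^bsub>mpol_ring\<^esub> f = power_ideal q +>\<^bsub>mpol_ring\<^esub> g \<longleftrightarrow> f - g \<in> power_ideal q"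
  using mpol.quotient_eq_iff_same_a_r_cos[OF ideal_power_ideal, of f g] by simp

text \<open>Stability under \<open>A\<close> gives one inclusion. For the other, \<open>h\<close>
  has the preimage \<open>f + linear_subst B (h - linear_subst A f)\<close>, and this lies in the
  coset of \<open>f\<close> because the ideal is also stable under the right inverse
  \<open>B\<close>.\<close>

lemma image_coset:
  assumes "\<And>f. f \<in> power_ideal q \<Longrightarrow> linear_subst A f \<in> power_ideal q"
    and "\<And>f. f \<in> power_ideal q \<Longrightarrow> linear_subst B f \<in> power_ideal q"
    and "\<And>f. linear_subst A (linear_subst B f) = f"
  shows "linear_subst A ` (power_ideal q +>\<^bsub>mpol_ring\<^esub> f) = power_ideal q +>\<^bsub>mpol_ring\<^esub> linear_subst A f"
proof (intro equalityI subsetI)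
  fix h assume "h \<in> linear_subst A ` (power_ideal q +>\<^bsub>mpol_ring\<^esub> f)"
  then show "h \<in> power_ideal q +>\<^bsub>mpol_ring\<^esub> linear_subst A f"
    using assms(1) by (auto simp: mem_coset_iff linear_subst_def simp flip: subst_diff)
next
  fix h assume "h \<in> power_ideal q +>\<^bsub>mpol_ring\<^esub> linear_subst A f"
  then have "linear_subst B (h - linear_subst A f) \<in> power_ideal q"
    using assms(2) by (simp add: mem_coset_iff)
  then have "f + linear_subst B (h - linear_subst A f) \<in> power_ideal q +>\<^bsub>mpol_ring\<^esub> f"
    by (simp add: mem_coset_iff)
  moreover have "linear_subst A (f + linear_subst B (h - linear_subst A f)) = h"
    by (simp add: linear_subst_def subst_add subst_diff assms(3)[unfolded linear_subst_def])
  ultimately show "h \<in> linear_subst A ` (power_ideal q +>\<^bsub>mpol_ring\<^esub> f)"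
    by force
qed

section \<open>Dimensions of the graded pieces\<close>

text \<open>Polynomial representatives of the invariant classes, so that calculations take place in
  the polynomial ring. \<open>M\<close> is a set of substitution matrices, with the inverse of
  \<open>act\<close> already applied, so that a conjugated group can be inserted directly.\<close>

definition invariants_mod :: "('k::field ^ 'n ^ 'n) set \<Rightarrow> nat \<Rightarrow> nat \<Rightarrow> ('n::finite, 'k) mpol set" where
  "invariants_mod M q d =
    {f \<in> homogeneous d. \<forall>A \<in> M. linear_subst A f - f \<in> power_ideal q}"

lemma subfield_range_Const: "subfield (range Const) (mpol_ring :: ('n, 'k::field) mpol ring)"
proof (rule mpol.subfieldI)
  show "subcring (range Const) (mpol_ring :: ('n, 'k) mpol ring)"
  proof (rule mpol.subcringI)
    show "subring (range Const) (mpol_ring :: ('n, 'k) mpol ring)"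
    proof (rule mpol.subringI)
      show "\<one>\<^bsub>mpol_ring\<^esub> \<in> range (Const :: 'k \<Rightarrow> ('n, 'k) mpol)"
        by (simp add: image_iff) (metis Const_1)
      fix x y :: "('n, 'k) mpol" assume "x \<in> range Const" "y \<in> range Const"
      then obtain a b where "x = Const a" "y = Const b"
        by auto
      then show "\<ominus>\<^bsub>mpol_ring\<^esub> x \<in> range Const" "x \<otimes>\<^bsub>mpol_ring\<^esub> y \<in> range Const"
          "x \<oplus>\<^bsub>mpol_ring\<^esub> y \<in> range Const"
        by (simp_all flip: Const_add Const_mult Const_uminus)
    qed simp
  qed (auto simp: mult.commute)
  show "Units ((mpol_ring :: ('n, 'k) mpol ring)\<lparr>carrier := range Const\<rparr>) = range Const - {\<zero>\<^bsub>mpol_ring\<^esub>}"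
  proof (intro equalityI subsetI)
    fix x :: "('n, 'k) mpol"
    assume "x \<in> range Const - {\<zero>\<^bsub>mpol_ring\<^esub>}"
    then obtain a where a: "x = Const a" "x \<noteq> 0"
      by auto
    then have "a \<noteq> 0"
      by (auto simp: Const_def)
    with a show "x \<in> Units (mpol_ring\<lparr>carrier := range Const\<rparr>)"
      by (auto simp: Units_def simp flip: Const_mult intro!: exI[of _ "inverse a"])
  qed (auto simp: Units_def)
qed

lemma inj_Const: "inj Const"
  unfolding Const_def by (rule inj_single)

text \<open>In HOL-Algebra, \<open>subalgebra\<close> means an additive subgroup closed under the
  scalars, that is, a linear subspace; products of its elements are not involved.\<close>

lemma subalgebra_invariants_mod:
  fixes M :: "('k::field ^ 'n::finite ^ 'n) set"
  shows "subalgebra (range Const) (invariants_mod M q d) mpol_ring"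
proof
  have "subgroup (invariants_mod M q d) (add_monoid mpol_ring)"
  proof (rule mpol_subgroupI)
    fix f g assume fg: "f \<in> invariants_mod M q d" "g \<in> invariants_mod M q d"
    have "linear_subst A (f - g) - (f - g) = (linear_subst A f - f) - (linear_subst A g - g)" for A
      by (simp add: linear_subst_def subst_diff)
    then have "linear_subst A (f - g) - (f - g) \<in> power_ideal q" if "A \<in> M" for A
      using fg that by (simp only: invariants_mod_def mem_Collect_eq power_ideal_diff)
    with fg show "f - g \<in> invariants_mod M q d"
      by (simp add: invariants_mod_def homogeneous_diff)
  qed (simp add: invariants_mod_def homogeneous_0 linear_subst_def power_ideal_0)
  then interpret subgroup "invariants_mod M q d" "add_monoid mpol_ring" .
  show "invariants_mod M q d \<subseteq> carrier (add_monoid mpol_ring)"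
    by (rule subset)
  show "\<one>\<^bsub>add_monoid mpol_ring\<^esub> \<in> invariants_mod M q d"
    by (rule one_closed)
  fix x y assume xy: "x \<in> invariants_mod M q d" "y \<in> invariants_mod M q d"
  show "x \<otimes>\<^bsub>add_monoid mpol_ring\<^esub> y \<in> invariants_mod M q d"
    using xy by (rule m_closed)
  show "inv\<^bsub>add_monoid mpol_ring\<^esub> x \<in> invariants_mod M q d"
    using xy(1) by (rule m_inv_closed)
next
  fix k f :: "('n, 'k) mpol" assume "k \<in> range Const" and f: "f \<in> invariants_mod M q d"
  then obtain c where c: "k = Const c"
    by auto
  have "linear_subst A (k * f) - k * f = k * (linear_subst A f - f)" for A
    by (simp add: c linear_subst_def subst_mult algebra_simps)
  with f show "k \<otimes>\<^bsub>mpol_ring\<^esub> f \<in> invariants_mod M q d"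
    by (simp add: invariants_mod_def c homogeneous_Const_mult power_ideal_mult)
qed

lemma quot_invariants_homogeneous_eq:
  fixes G :: "('k::field ^ 'n::finite ^ 'n) set"
  assumes "prime CHAR('k)" and q: "q = CHAR('k) ^ m" and "\<And>g. g \<in> G \<Longrightarrow> invertible g"
  shows "quot_invariants G (power_ideal q) \<inter> quot_homogeneous (power_ideal q) d =
    (+>\<^bsub>mpol_ring\<^esub>) (power_ideal q) ` invariants_mod (matrix_inv ` G) q d"
proof -
  note stable = linear_subst_power_ideal[OF assms(1), of _ m, folded q]
  have act: "act g ` (power_ideal q +>\<^bsub>mpol_ring\<^esub> f) = power_ideal q +>\<^bsub>mpol_ring\<^esub> f \<longleftrightarrow>
      linear_subst (matrix_inv g) f - f \<in> power_ideal q" if "g \<in> G" for g f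
    using image_coset[of q "matrix_inv g" g f] assms(3)[OF that]
    by (simp add: act_eq_linear_subst stable linear_subst_inverse coset_eq_iff)
  have "carrier (mpol_ring Quot power_ideal q) = range ((+>\<^bsub>mpol_ring\<^esub>) (power_ideal q :: ('n, 'k) mpol set))"
    by (auto simp: FactRing_def A_RCOSETS_def RCOSETS_def a_r_coset_def)
  then have "quot_invariants G (power_ideal q) \<inter> quot_homogeneous (power_ideal q) d =
      (+>\<^bsub>mpol_ring\<^esub>) (power_ideal q) ` {f \<in> homogeneous d.
        \<forall>g\<in>G. act g ` (power_ideal q +>\<^bsub>mpol_ring\<^esub> f) = power_ideal q +>\<^bsub>mpol_ring\<^esub> f}"
    unfolding quot_invariants_def quot_homogeneous_def by (auto simp only:)
  also have "{f \<in> homogeneous d. \<forall>g\<in>G. act g ` (power_ideal q +>\<^bsub>mpol_ring\<^esub> f) = power_ideal q +>\<^bsub>mpol_ring\<^esub> f} =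
      invariants_mod (matrix_inv ` G) q d"
    by (simp add: invariants_mod_def act)
  finally show ?thesis .
qed

text \<open>As \<open>1\<close> is not in the ideal, the constants embed into the quotient ring. Its
  scalar field therefore has \<open>CARD('k)\<close> elements, and the number of classes determines
  the dimension.\<close>

lemma dim_quot_invariants_eq:
  fixes G :: "('k::{field, finite} ^ 'n::finite ^ 'n) set"
  assumes p: "prime CHAR('k)" and q: "q = CHAR('k) ^ m" and "\<And>g. g \<in> G \<Longrightarrow> invertible g"
    and card: "card ((+>\<^bsub>mpol_ring\<^esub>) (power_ideal q) ` invariants_mod (matrix_inv ` G) q d) = CARD('k) ^ N"
  shows "ring.dim (mpol_ring Quot power_ideal q) (range (\<lambda>c. power_ideal q +>\<^bsub>mpol_ring\<^esub> Const c))
     (quot_invariants G (power_ideal q) \<inter> quot_homogeneous (power_ideal q) d) = N"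
proof -
  let ?I = "power_ideal q :: ('n, 'k) mpol set"
  let ?\<pi> = "(+>\<^bsub>mpol_ring\<^esub>) ?I"
  interpret I: ideal ?I mpol_ring
    by (rule ideal_power_ideal)
  interpret \<pi>: ring_hom_ring mpol_ring "mpol_ring Quot ?I" ?\<pi>
    by (rule I.rcos_ring_hom_ring)
  have "0 < q"
    using p by (simp add: q prime_gt_0_nat)
  then have "(1 :: ('n, 'k) mpol) \<notin> ?I"
    by (simp add: mem_power_ideal_iff)
  then have "\<one>\<^bsub>mpol_ring Quot ?I\<^esub> \<noteq> \<zero>\<^bsub>mpol_ring Quot ?I\<^esub>"
    using coset_eq_iff[of q 1 "0 :: ('n, 'k) mpol"] \<pi>.hom_one \<pi>.hom_zero by simp
  from \<pi>.img_is_subfield[OF subfield_range_Const this]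
  have inj: "inj_on ?\<pi> (range Const)" and K: "subfield (?\<pi> ` range Const) (mpol_ring Quot ?I)"
    by auto
  have cardK: "card (?\<pi> ` range Const) = CARD('k)"
    using inj by (simp add: card_image inj_Const)
  have "subalgebra (?\<pi> ` range Const) (?\<pi> ` invariants_mod (matrix_inv ` G) q d) (mpol_ring Quot ?I)"
    by (rule \<pi>.img_is_subalgebra[OF _ subalgebra_invariants_mod]) simp
  with K have "ring.dim (mpol_ring Quot ?I) (?\<pi> ` range Const) (?\<pi> ` invariants_mod (matrix_inv ` G) q d) = N"
    by (rule \<pi>.S.dim_eq_if_card) (simp_all add: cardK card)
  then show ?thesis
    by (simp add: quot_invariants_homogeneous_eq[OF p q assms(3)] image_image)
qed

text \<open>In degree \<open>d < q\<close> congruence modulo the ideal is equality, so invariance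
  modulo the ideal is invariance and distinct polynomials have distinct classes. The count made for
  the quotient then serves for the invariant ring as well.\<close>

lemma dim_invariants_eq:
  fixes G :: "('k::{field, finite} ^ 'n::finite ^ 'n) set"
  assumes "d < q"
    and card: "card ((+>\<^bsub>mpol_ring\<^esub>) (power_ideal q) ` invariants_mod (matrix_inv ` G) q d) = CARD('k) ^ N"
  shows "ring.dim mpol_ring (range Const) (invariants G \<inter> homogeneous d) = N"
proof -
  have eq: "invariants G \<inter> homogeneous d = invariants_mod (matrix_inv ` G) q d"
  proof -
    have "linear_subst A f - f \<in> power_ideal q \<longleftrightarrow> linear_subst A f = f"
      if "f \<in> homogeneous d" for A and f :: "('n, 'k) mpol"
      using homogeneous_power_ideal_eq_0[of "linear_subst A f - f" q d] that assms(1)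
      by (auto simp: homogeneous_diff homogeneous_linear_subst power_ideal_0)
    then show ?thesis
      by (auto simp: invariants_def invariants_mod_def act_eq_linear_subst)
  qed
  have "inj_on ((+>\<^bsub>mpol_ring\<^esub>) (power_ideal q)) (invariants_mod (matrix_inv ` G) q d)"
  proof (rule inj_onI)
    fix f g assume fg: "f \<in> invariants_mod (matrix_inv ` G) q d" "g \<in> invariants_mod (matrix_inv ` G) q d"
      and "power_ideal q +>\<^bsub>mpol_ring\<^esub> f = power_ideal q +>\<^bsub>mpol_ring\<^esub> g"
    then have "f - g \<in> power_ideal q" "f - g \<in> homogeneous d"
      by (auto simp: coset_eq_iff invariants_mod_def homogeneous_diff)
    then show "f = g"
      using homogeneous_power_ideal_eq_0[of "f - g" q d] assms(1) by simp
  qed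
  with card have "card (invariants_mod (matrix_inv ` G) q d) = card (range (Const :: 'k \<Rightarrow> ('n, 'k) mpol)) ^ N"
    by (simp add: card_image inj_Const)
  then show ?thesis
    unfolding eq by (intro mpol.dim_eq_if_card subfield_range_Const subalgebra_invariants_mod) simp_all
qed

text \<open>A linear change of coordinates preserves both the ideal and the grading, so
  \<open>linear_subst P\<close> permutes the cosets and carries the invariants of the conjugated set
  onto those of \<open>M\<close>.\<close>

lemma card_cosets_conjugate:
  fixes M :: "('k::field ^ 'n::finite ^ 'n) set" and P Q :: "'k ^ 'n ^ 'n"
  assumes "prime CHAR('k)" and q: "q = CHAR('k) ^ m" 
    and PQ: "P ** Q = mat 1" "Q ** P = mat 1"
  shows "card ((+>\<^bsub>mpol_ring\<^esub>) (power_ideal q) ` invariants_mod M q d) =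
         card ((+>\<^bsub>mpol_ring\<^esub>) (power_ideal q) ` invariants_mod ((\<lambda>A. P ** A ** Q) ` M) q d)"
proof -
  note stable = linear_subst_power_ideal[OF assms(1), of _ m, folded q]
  let ?N = "(\<lambda>A. P ** A ** Q) ` M"
  have inv: "linear_subst P (linear_subst Q f) = f" "linear_subst Q (linear_subst P f) = f"
    for f :: "('n, 'k) mpol"
    by (simp_all add: linear_subst_matrix_mul PQ)
  note coset = image_coset[of q P Q, OF stable stable inv(1)]
  have conj: "linear_subst A (linear_subst P f) = linear_subst P (linear_subst (P ** A ** Q) f)"
    for A and f :: "('n, 'k) mpol"
    by (simp add: linear_subst_matrix_mul PQ flip: matrix_mul_assoc)
  have mem: "linear_subst P f \<in> power_ideal q \<longleftrightarrow> f \<in> power_ideal q" for f :: "('n, 'k) mpol"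
    using stable[of f P] stable[of "linear_subst P f" Q] by (auto simp: inv)
  have hom: "linear_subst P f \<in> homogeneous d \<longleftrightarrow> f \<in> homogeneous d" for f :: "('n, 'k) mpol"
    using homogeneous_linear_subst[of f d P] homogeneous_linear_subst[of "linear_subst P f" d Q]
    by (auto simp: inv)
  have diff: "linear_subst A (linear_subst P f) - linear_subst P f =
      linear_subst P (linear_subst (P ** A ** Q) f - f)" for A and f :: "('n, 'k) mpol"
    unfolding conj by (simp add: linear_subst_def subst_diff)
  have "linear_subst P f \<in> invariants_mod M q d \<longleftrightarrow> f \<in> invariants_mod ?N q d" for f
    by (simp add: invariants_mod_def hom diff mem)
  then have "invariants_mod ?N q d = linear_subst P -` invariants_mod M q d"
    by auto
  moreover have "surj (linear_subst P :: ('n, 'k) mpol \<Rightarrow> _)"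
    using inv(1) by (rule surjI)
  ultimately have "invariants_mod M q d = linear_subst P ` invariants_mod ?N q d"
    by simp
  then have "(+>\<^bsub>mpol_ring\<^esub>) (power_ideal q) ` invariants_mod M q d =
      (`) (linear_subst P) ` ((+>\<^bsub>mpol_ring\<^esub>) (power_ideal q) ` invariants_mod ?N q d)"
    by (simp add: image_image coset)
  moreover have "inj ((`) (linear_subst P :: ('n, 'k) mpol \<Rightarrow> _))"
    by (rule inj_on_image, rule inj_on_inverseI[of _ "linear_subst Q"]) (simp add: inv)
  ultimately show ?thesis
    by (simp add: card_image inj_on_subset)
qed

section \<open>Groups in normal form\<close>

text \<open>The matrix of the map that adds \<open>v $ i0\<close> times \<open>c\<close> to
  \<open>v\<close>: an element with root \<open>c\<close> in coordinates where \<open>l\<close> is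
  the coordinate \<open>i0\<close>.\<close>

definition axis_matrix :: "'n \<Rightarrow> 'k::comm_ring_1 ^ 'n \<Rightarrow> 'k ^ 'n ^ 'n" where
  "axis_matrix i0 c = (\<chi> i j. (if i = j then 1 else 0) + (if j = i0 then c $ i else 0))"

text \<open>The coordinates of the root in \<open>L\<close> are arbitrary. The number
  \<open>1 + c $ i0\<close> is the determinant and also the factor by which \<open>Var i0\<close> is
  scaled; for the groups at hand, \<open>U\<close> is the group of these factors.\<close>

definition normal_form :: "'n \<Rightarrow> 'n set \<Rightarrow> 'k::comm_ring_1 set \<Rightarrow> ('k ^ 'n ^ 'n) set" where
  "normal_form i0 L U =
    axis_matrix i0 ` {c. (\<forall>i. i \<notin> insert i0 L \<longrightarrow> c $ i = 0) \<and> 1 + c $ i0 \<in> U}"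

text \<open>
  The monomials that can occur in the part of lowest degree in \<open>Var i0\<close> of a class of degree \<open>d\<close>
  that is invariant modulo \<open>power_ideal q\<close>.
\<close>

definition leading_exponents :: "'n::finite \<Rightarrow> 'n set \<Rightarrow> nat \<Rightarrow> nat \<Rightarrow> nat \<Rightarrow> nat \<Rightarrow> ('n \<Rightarrow>\<^sub>0 nat) set" where
  "leading_exponents i0 L p e q d = {a. (\<Sum>i\<in>UNIV. Poly_Mapping.lookup a i) = d \<and>
     (\<forall>i. Poly_Mapping.lookup a i < q) \<and>
     (Poly_Mapping.lookup a i0 = q - 1 \<or>
      e dvd Poly_Mapping.lookup a i0 \<and> (\<forall>i\<in>L. p dvd Poly_Mapping.lookup a i))}"

section \<open>Effect of transvections and homotheties on coefficients\<close>

lemma linear_subst_axis_matrix: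
  "linear_subst (axis_matrix i0 c) f = subst (\<lambda>i. Var i + Const (c $ i) * Var i0) f"
proof -
  have "(\<Sum>j\<in>UNIV. Const (axis_matrix i0 c $ i $ j) * Var j) = Var i + Const (c $ i) * Var i0" for i
    by (simp add: axis_matrix_def Const_add algebra_simps sum.distrib if_distrib[of Const]
        if_distrib[of "(*) _"] cong: if_cong)
  then show ?thesis
    by (simp add: linear_subst_def)
qed

lemma lookup_eq_0_if_Var_power_dvd:
  assumes "Var i ^ k dvd f" "Poly_Mapping.lookup a i < k"
  shows "Poly_Mapping.lookup f a = 0"
proof (rule ccontr)
  assume "Poly_Mapping.lookup f a \<noteq> 0"
  obtain g where "f = Var i ^ k * g"
    using assms(1) by (auto simp: dvd_def)
  with \<open>Poly_Mapping.lookup f a \<noteq> 0\<close> have "a \<in> Poly_Mapping.keys (Var i ^ k * g)"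
    by (simp add: in_keys_iff)
  then obtain b where "a = Poly_Mapping.single i k + b"
    using keys_mult[of "Var i ^ k" g] by (auto simp: Var_power split: if_splits)
  with assms(2) show False
    by (simp add: lookup_add)
qed

text \<open>The binomial expansion to first order in \<open>z\<close>. For \<open>k = 0\<close> the
  truncated exponent \<open>k - 1\<close> is harmless, since its coefficient is
  \<open>of_nat 0\<close>.\<close>

lemma power_add_mod_square:
  fixes x z :: "'a::comm_ring_1"
  shows "z ^ 2 dvd (x + z) ^ k - x ^ k - of_nat k * x ^ (k - 1) * z"
proof (induction k)
  case (Suc k)
  have "(x + z) ^ Suc k - x ^ Suc k - of_nat (Suc k) * x ^ k * z =
      (x + z) * ((x + z) ^ k - x ^ k - of_nat k * x ^ (k - 1) * z) + z ^ 2 * (of_nat k * x ^ (k - 1))"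
    by (cases k) (simp_all add: algebra_simps power2_eq_square)
  then show ?case
    using Suc by simp
qed simp

lemma single_split_variable:
  fixes a :: "'n::finite \<Rightarrow>\<^sub>0 nat"
  shows "(\<Prod>j\<in>UNIV. \<phi> j ^ Poly_Mapping.lookup a j) =
    \<phi> i ^ Poly_Mapping.lookup a i * (\<Prod>j\<in>UNIV - {i}. \<phi> j ^ Poly_Mapping.lookup a j)"
  by (rule prod.remove) auto

text \<open>
  Taylor expansion to first order in \<open>Var i0\<close>. If \<open>Poly_Mapping.lookup a i = 0\<close>, then
  \<open>a - Poly_Mapping.single i 1\<close> is truncated, but the coefficient of that monomial is zero.
\<close>

lemma transvection_single:
  fixes a :: "'n::finite \<Rightarrow>\<^sub>0 nat" and c :: "'k::comm_ring_1"
  assumes "i \<noteq> i0"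
  shows "Var i0 ^ (Poly_Mapping.lookup a i0 + 2) dvd
    linear_subst (axis_matrix i0 (\<chi> j. if j = i then 1 else 0)) (Poly_Mapping.single a c)
      - Poly_Mapping.single a c
      - Poly_Mapping.single (a - Poly_Mapping.single i 1 + Poly_Mapping.single i0 1)
          (of_nat (Poly_Mapping.lookup a i) * c)"
    (is "_ dvd ?\<tau> - _ - ?s")
proof -
  let ?k = "Poly_Mapping.lookup a i"
  let ?z = "Var i0 :: ('n, 'k) mpol"
  let ?x = "Var i :: ('n, 'k) mpol"
  let ?R = "\<Prod>j\<in>UNIV - {i}. Var j ^ Poly_Mapping.lookup a j :: ('n, 'k) mpol"
  let ?\<phi> = "\<lambda>j. Var j + Const ((\<chi> j. if j = i then 1 else 0) $ j) * Var i0 :: ('n, 'k) mpol"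
  have "(\<Prod>j\<in>UNIV - {i}. ?\<phi> j ^ Poly_Mapping.lookup a j) = ?R"
    by (rule prod.cong) auto
  then have \<tau>: "?\<tau> = Const c * ((?x + ?z) ^ ?k * ?R)"
    by (simp add: linear_subst_axis_matrix subst_single single_split_variable[of _ _ i])
  have s: "?s = of_nat ?k * ?x ^ (?k - 1) * ?z * (Const c * ?R)"
  proof (cases "?k = 0")
    case False
    let ?b = "a - Poly_Mapping.single i 1"
    have "(\<Prod>j\<in>UNIV - {i}. Var j ^ Poly_Mapping.lookup ?b j) = ?R"
      by (rule prod.cong) (auto simp: lookup_minus lookup_single when_def)
    then have "Poly_Mapping.single ?b c = Const c * (?x ^ (?k - 1) * ?R)"
      by (simp only: single_eq_monomial single_split_variable[of _ _ i]) (simp add: lookup_minus)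
    moreover have "?s = of_nat ?k * (?z * Poly_Mapping.single ?b c)"
      by (simp add: Var_def mult_single add.commute flip: single_of_nat)
    ultimately show ?thesis
      by (simp add: ac_simps)
  qed simp
  have "Poly_Mapping.single a c = Const c * (?x ^ ?k * ?R)"
    by (simp add: single_eq_monomial single_split_variable[of _ _ i])
  then have eq: "?\<tau> - Poly_Mapping.single a c - ?s =
      ((?x + ?z) ^ ?k - ?x ^ ?k - of_nat ?k * ?x ^ (?k - 1) * ?z) * ?R * Const c"
    unfolding \<tau> s by (simp add: algebra_simps)
  \<comment> \<open>As \<open>i\<close> differs from \<open>i0\<close>, the power of
    \<open>?z\<close> in the monomial is untouched and sits in \<open>?R\<close>; together with the
    square from the Taylor remainder it gives the exponent increased by 2.\<close>
  have "?z ^ Poly_Mapping.lookup a i0 dvd ?R"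
    using assms by (intro dvd_prodI[of _ _ "\<lambda>j. Var j ^ Poly_Mapping.lookup a j"]) auto
  then have "?z ^ 2 * ?z ^ Poly_Mapping.lookup a i0 dvd
      ((?x + ?z) ^ ?k - ?x ^ ?k - of_nat ?k * ?x ^ (?k - 1) * ?z) * ?R"
    by (rule mult_dvd_mono[OF power_add_mod_square])
  moreover have "?z ^ (Poly_Mapping.lookup a i0 + 2) = ?z ^ 2 * ?z ^ Poly_Mapping.lookup a i0"
    by (simp only: power_add mult.commute)
  ultimately show ?thesis
    unfolding eq by (simp only: dvd_mult2)
qed

lemma lookup_subst:
  "Poly_Mapping.lookup (subst \<phi> f) b =
    (\<Sum>a\<in>Poly_Mapping.keys f. Poly_Mapping.lookup (subst \<phi> (Poly_Mapping.single a (Poly_Mapping.lookup f a))) b)"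
  by (simp add: subst_def[of \<phi> f] lookup_sum subst_single)

text \<open>The root lies on the axis \<open>i0\<close>, so the substitution only scales
  \<open>Var i0\<close> by \<open>1 + (u - 1) = u\<close> and every monomial is an
  eigenvector.\<close>

lemma lookup_homothety:
  fixes f :: "('n::finite, 'k::comm_ring_1) mpol"
  shows "Poly_Mapping.lookup (linear_subst (axis_matrix i0 (\<chi> j. if j = i0 then u - 1 else 0)) f) a =
    u ^ Poly_Mapping.lookup a i0 * Poly_Mapping.lookup f a"
proof -
  let ?\<phi> = "\<lambda>j. Var j + Const ((\<chi> j. if j = i0 then u - 1 else 0) $ j) * Var i0 :: ('n, 'k) mpol"
  have "subst ?\<phi> (Poly_Mapping.single b c) = Poly_Mapping.single b (u ^ Poly_Mapping.lookup b i0 * c)" for b c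
  proof -
    have "(\<Prod>j\<in>UNIV - {i0}. ?\<phi> j ^ Poly_Mapping.lookup b j) = (\<Prod>j\<in>UNIV - {i0}. Var j ^ Poly_Mapping.lookup b j)"
      by (rule prod.cong) auto
    moreover have "?\<phi> i0 = Const u * Var i0"
      by (simp add: Const_diff algebra_simps)
    ultimately show ?thesis
      unfolding subst_single unfolding single_split_variable[of _ _ i0] single_eq_monomial
      by (simp add: power_mult_distrib Const_mult Const_power ac_simps)
  qed
  then show ?thesis
    by (subst linear_subst_axis_matrix, subst lookup_subst)
      (auto simp: lookup_single when_def in_keys_iff)
qed

section \<open>Conditions on the lowest term of an invariant class\<close>

text \<open>The normal form modulo a monomial ideal: every class has one representative none of
  whose monomials lies in the ideal.\<close>

definition reduced_part :: "nat \<Rightarrow> ('n::finite, 'k::comm_ring_1) mpol \<Rightarrow> ('n, 'k) mpol" where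
  "reduced_part q f =
    (\<Sum>a\<in>{a \<in> Poly_Mapping.keys f. \<forall>i. Poly_Mapping.lookup a i < q}. Poly_Mapping.single a (Poly_Mapping.lookup f a))"

lemma lookup_reduced_part:
  "Poly_Mapping.lookup (reduced_part q f) a =
    (if \<forall>i. Poly_Mapping.lookup a i < q then Poly_Mapping.lookup f a else 0)"
  by (auto simp: reduced_part_def lookup_sum lookup_single when_def in_keys_iff)

lemma diff_reduced_part_in_power_ideal: "f - reduced_part q f \<in> power_ideal q"
  by (auto simp: mem_power_ideal_iff in_keys_iff lookup_minus lookup_reduced_part not_less split: if_splits)

lemma homogeneous_reduced_part: "f \<in> homogeneous d \<Longrightarrow> reduced_part q f \<in> homogeneous d"
  by (auto simp: homogeneous_def in_keys_iff lookup_reduced_part split: if_splits)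

lemma lookup_eq_0_if_power_ideal:
  fixes f :: "('n::finite, 'k::comm_ring_1) mpol"
  shows "f \<in> power_ideal q \<Longrightarrow> \<forall>i. Poly_Mapping.lookup a i < q \<Longrightarrow> Poly_Mapping.lookup f a = 0"
  by (meson in_keys_iff mem_power_ideal_iff not_less)

text \<open>This is the coefficient of the derivative by \<open>Var i\<close>, moved up one step in
  \<open>Var i0\<close>. The second-order remainder of a monomial \<open>b\<close> starts at degree
  \<open>Poly_Mapping.lookup b i0 + 2\<close> in \<open>Var i0\<close>, which by minimality is too
  high to interfere, and the shift of exponents is injective where the exponent of \<open>i\<close>
  is positive.\<close>

lemma transvection_lowest_coefficient:
  fixes f :: "('n::finite, 'k::comm_ring_1) mpol"
  assumes "i \<noteq> i0" and a: "0 < Poly_Mapping.lookup a i"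
    and min: "\<And>b. b \<in> Poly_Mapping.keys f \<Longrightarrow> Poly_Mapping.lookup a i0 \<le> Poly_Mapping.lookup b i0"
  shows "Poly_Mapping.lookup (linear_subst (axis_matrix i0 (\<chi> j. if j = i then 1 else 0)) f - f)
      (a - Poly_Mapping.single i 1 + Poly_Mapping.single i0 1) =
    of_nat (Poly_Mapping.lookup a i) * Poly_Mapping.lookup f a"
proof -
  let ?\<tau> = "linear_subst (axis_matrix i0 (\<chi> j. if j = i then 1 else 0)) :: ('n, 'k) mpol \<Rightarrow> _"
  let ?sh = "\<lambda>a. a - Poly_Mapping.single i 1 + Poly_Mapping.single i0 1"
  let ?m = "\<lambda>b. Poly_Mapping.single b (Poly_Mapping.lookup f b)"
  have "Poly_Mapping.lookup (?\<tau> (?m b) - ?m b) (?sh a) =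
      (if b = a then of_nat (Poly_Mapping.lookup a i) * Poly_Mapping.lookup f a else 0)"
    if b: "b \<in> Poly_Mapping.keys f" for b
  proof -
    have "Poly_Mapping.lookup (?\<tau> (?m b) - ?m b
        - Poly_Mapping.single (?sh b) (of_nat (Poly_Mapping.lookup b i) * Poly_Mapping.lookup f b)) (?sh a) = 0"
      using min[OF b] assms(1)
      by (intro lookup_eq_0_if_Var_power_dvd[OF transvection_single])
        (simp_all add: lookup_add lookup_minus lookup_single when_def)
    \<comment> \<open>Truncated subtraction spoils the injectivity of \<open>?sh\<close> where the
      exponent of \<open>i\<close> is 0; such \<open>b\<close> enter with the coefficient 0 and are
      treated apart.\<close>
    moreover have "b = a" if "?sh b = ?sh a" "0 < Poly_Mapping.lookup b i"
    proof (rule poly_mapping_eqI)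
      fix j
      have "Poly_Mapping.lookup (?sh b) j = Poly_Mapping.lookup (?sh a) j"
        using that(1) by simp
      then show "Poly_Mapping.lookup b j = Poly_Mapping.lookup a j"
        using that(2) a by (auto simp: lookup_add lookup_minus lookup_single when_def split: if_splits)
    qed
    ultimately show ?thesis
      by (cases "Poly_Mapping.lookup b i = 0") (auto simp: lookup_minus lookup_single when_def)
  qed
  then have "(\<Sum>b\<in>Poly_Mapping.keys f. Poly_Mapping.lookup (?\<tau> (?m b) - ?m b) (?sh a)) =
      of_nat (Poly_Mapping.lookup a i) * Poly_Mapping.lookup f a"
    by (simp add: in_keys_iff)
  moreover have "?\<tau> f - f = (\<Sum>b\<in>Poly_Mapping.keys f. ?\<tau> (?m b) - ?m b)"
    using mpol_sum_monomials[of f]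
    by (simp add: sum_subtractf linear_subst_def flip: subst_sum)
  ultimately show ?thesis
    by (simp add: lookup_sum)
qed

text \<open>
  One has to pass to the reduced part of \<open>f\<close>, because a monomial of \<open>f\<close> in the ideal may have
  smaller degree in \<open>Var i0\<close> than every monomial outside the ideal.
\<close>

lemma normal_form_lookup_leading_exponents:
  fixes f :: "('n::finite, 'p::prime_card mod_ring) mpol"
  assumes "i0 \<notin> L" and U: "U = range (\<lambda>k::nat. u ^ k)" and e: "\<And>j. u ^ j = 1 \<longleftrightarrow> e dvd j"
    and q: "q = CARD('p) ^ m"
    and f: "f \<in> invariants_mod (normal_form i0 L U) q d"
    and 0: "\<And>a. a \<in> leading_exponents i0 L CARD('p) e q d \<Longrightarrow> Poly_Mapping.lookup f a = 0"
  shows "f \<in> power_ideal q"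
proof (rule ccontr)
  assume "f \<notin> power_ideal q"
  define r where "r = reduced_part q f"
  have fr: "f - r \<in> power_ideal q"
    unfolding r_def by (rule diff_reduced_part_in_power_ideal)
  then have "r \<noteq> 0"
    using \<open>f \<notin> power_ideal q\<close> by auto
  then obtain a0 where "a0 \<in> Poly_Mapping.keys r"
    by (metis all_not_in_conv keys_eq_empty)
  then obtain a where a: "a \<in> Poly_Mapping.keys r"
    and min: "\<And>b. b \<in> Poly_Mapping.keys r \<Longrightarrow> Poly_Mapping.lookup a i0 \<le> Poly_Mapping.lookup b i0"
    using ex_has_least_nat[of "\<lambda>a. a \<in> Poly_Mapping.keys r" a0 "\<lambda>a. Poly_Mapping.lookup a i0"] by blast
  have ra: "Poly_Mapping.lookup r a \<noteq> 0"
    using a by (simp add: in_keys_iff)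
  then have red: "\<forall>i. Poly_Mapping.lookup a i < q" and fa: "Poly_Mapping.lookup f a \<noteq> 0"
    by (auto simp: r_def lookup_reduced_part split: if_splits)
  have "r \<in> homogeneous d"
    using f by (simp add: r_def invariants_mod_def homogeneous_reduced_part)
  then have deg: "(\<Sum>i\<in>UNIV. Poly_Mapping.lookup a i) = d"
    using a by (auto simp: homogeneous_def)
  have inv: "linear_subst A r - r \<in> power_ideal q" if "A \<in> normal_form i0 L U" for A
  proof -
    have "linear_subst A (f - r) \<in> power_ideal q"
      using linear_subst_power_ideal[of "f - r" m A] fr by (simp add: q prime_card)
    moreover have "linear_subst A f - f \<in> power_ideal q"
      using f that by (simp add: invariants_mod_def)
    ultimately have "(linear_subst A f - f) - linear_subst A (f - r) + (f - r) \<in> power_ideal q"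
      using fr power_ideal_add power_ideal_diff by blast
    then show ?thesis
      by (simp add: linear_subst_def subst_diff)
  qed
  have notin: "a \<notin> leading_exponents i0 L CARD('p) e q d"
    using 0 fa by blast
  then have "Poly_Mapping.lookup a i0 \<noteq> q - 1"
    using red deg by (simp add: leading_exponents_def)
  \<comment> \<open>The exponent of \<open>i0\<close> can now be raised by one and stays below
    \<open>q\<close>, so the shifted monomial is outside the ideal and its coefficient in
    \<open>linear_subst A r - r\<close> has to vanish.\<close>
  then have lt: "Poly_Mapping.lookup a i0 < q - 1"
    using red[rule_format, of i0] by linarith
  have "e dvd Poly_Mapping.lookup a i0"
  proof -
    \<comment> \<open>The generating homothety: its factor is \<open>u ^ 1\<close>.\<close>
    have "axis_matrix i0 (\<chi> j. if j = i0 then u - 1 else 0) \<in> normal_form i0 L U"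
      unfolding normal_form_def U by (rule imageI) (auto intro: range_eqI[of _ _ 1])
    from lookup_eq_0_if_power_ideal[OF inv[OF this] red]
    have "u ^ Poly_Mapping.lookup a i0 * Poly_Mapping.lookup r a - Poly_Mapping.lookup r a = 0"
      by (simp add: lookup_minus lookup_homothety)
    with ra show ?thesis
      by (simp add: e)
  qed
  moreover have "CARD('p) dvd Poly_Mapping.lookup a i" if i: "i \<in> L" for i
  proof (cases "Poly_Mapping.lookup a i = 0")
    case False
    have "i \<noteq> i0"
      using i assms(1) by auto
    \<comment> \<open>The elementary transvection along \<open>i\<close>: its root has coordinate 0
      at \<open>i0\<close>, so its factor is \<open>u ^ 0\<close>.\<close>
    have "axis_matrix i0 (\<chi> j. if j = i then 1 else 0) \<in> normal_form i0 L U"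
      unfolding normal_form_def U using i \<open>i \<noteq> i0\<close> by (intro imageI) (auto intro: range_eqI[of _ _ 0])
    note inv[OF this]
    moreover have "\<forall>j. Poly_Mapping.lookup (a - Poly_Mapping.single i 1 + Poly_Mapping.single i0 1) j < q"
    proof
      fix j
      show "Poly_Mapping.lookup (a - Poly_Mapping.single i 1 + Poly_Mapping.single i0 1) j < q"
        using red[rule_format, of j] lt \<open>i \<noteq> i0\<close> by (auto simp: lookup_add lookup_minus lookup_single when_def)
    qed
    ultimately have "of_nat (Poly_Mapping.lookup a i) * Poly_Mapping.lookup r a = 0"
      using transvection_lowest_coefficient[of i i0 a r] \<open>i \<noteq> i0\<close> False min lookup_eq_0_if_power_ideal
      by (metis neq0_conv)
    with ra have "of_nat (Poly_Mapping.lookup a i) = (0 :: 'p mod_ring)"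
      by simp
    then show ?thesis
      by (simp add: of_nat_eq_0_iff_char_dvd)
  qed simp
  ultimately show False
    using notin red deg by (simp add: leading_exponents_def)
qed

text \<open>
  An invariant with leading monomial \<open>a\<close>, obtained by replacing $x_i^p$ for $i \in L$ with the
  product $x_i^p - x_i z^{p-1}$ of the forms $x_i + c z$.
\<close>

definition lead_lift :: "'n \<Rightarrow> 'n set \<Rightarrow> nat \<Rightarrow> nat \<Rightarrow> ('n \<Rightarrow>\<^sub>0 nat) \<Rightarrow> ('n::finite, 'k::comm_ring_1) mpol" where
  "lead_lift i0 L p q a = (if Poly_Mapping.lookup a i0 = q - 1 then Poly_Mapping.single a 1
    else Var i0 ^ Poly_Mapping.lookup a i0 * (\<Prod>i\<in>UNIV - {i0}.
      if i \<in> L then (Var i ^ p - Var i * Var i0 ^ (p - 1)) ^ (Poly_Mapping.lookup a i div p)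
      else Var i ^ Poly_Mapping.lookup a i))"

section \<open>Invariants with a prescribed lowest term\<close>

lemma homogeneous_lead_lift:
  assumes a: "a \<in> leading_exponents i0 L p e q d" and "0 < p"
  shows "lead_lift i0 L p q a \<in> homogeneous d"
proof (cases "Poly_Mapping.lookup a i0 = q - 1")
  case True
  then show ?thesis
    using a by (simp add: lead_lift_def homogeneous_def leading_exponents_def)
next
  case False
  have d: "d = Poly_Mapping.lookup a i0 * 1 + (\<Sum>i\<in>UNIV - {i0}. Poly_Mapping.lookup a i)"
    using a by (simp add: leading_exponents_def flip: sum.remove)
  have N: "Var i ^ p - Var i * Var i0 ^ (p - 1) \<in> homogeneous p" for i :: 'a
  proof (rule homogeneous_diff)
    show "Var i ^ p \<in> homogeneous p"
      using homogeneous_power[OF homogeneous_Var, of i p] by simp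
    show "Var i * Var i0 ^ (p - 1) \<in> homogeneous p"
      using homogeneous_mult[OF homogeneous_Var[of i] homogeneous_power[OF homogeneous_Var[of i0], of "p - 1"]]
        assms(2)
      by simp
  qed
  have "(if i \<in> L then (Var i ^ p - Var i * Var i0 ^ (p - 1)) ^ (Poly_Mapping.lookup a i div p)
      else Var i ^ Poly_Mapping.lookup a i) \<in> homogeneous (Poly_Mapping.lookup a i)" for i
  proof (cases "i \<in> L")
    case True
    then have "p dvd Poly_Mapping.lookup a i"
      using a False by (auto simp: leading_exponents_def)
    with True show ?thesis
      using homogeneous_power[OF N, of i "Poly_Mapping.lookup a i div p"] by simp
  next
    case False
    then show ?thesis
      using homogeneous_power[OF homogeneous_Var, of i "Poly_Mapping.lookup a i"] by simp
  qed
  then show ?thesis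
    unfolding d lead_lift_def if_not_P[OF False]
    by (intro homogeneous_mult homogeneous_power homogeneous_Var homogeneous_prod)
qed

text \<open>As \<open>p - 1\<close> is positive, the two bases are congruent modulo
  \<open>Var i0\<close>, and a difference of bases divides the difference of their powers.\<close>

lemma Var_dvd_norm_power_diff:
  assumes "1 < p" "p dvd k"
  shows "Var i0 dvd (Var i ^ p - Var i * Var i0 ^ (p - 1)) ^ (k div p) - Var i ^ k"
proof -
  have "Var i0 dvd (Var i ^ p - Var i * Var i0 ^ (p - 1)) - Var i ^ p"
    using assms(1) by (simp add: dvd_power)
  also have "\<dots> dvd (Var i ^ p - Var i * Var i0 ^ (p - 1)) ^ (k div p) - (Var i ^ p) ^ (k div p)"
    by (simp only: power_diff_sumr2 dvd_triv_left)
  finally show ?thesis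
    using assms(2) by (simp flip: power_mult)
qed

lemma dvd_prod_diff:
  fixes f g :: "'b \<Rightarrow> 'a::comm_ring_1"
  assumes "\<And>x. x \<in> A \<Longrightarrow> z dvd f x - g x"
  shows "z dvd prod f A - prod g A"
  using assms
proof (induction A rule: infinite_finite_induct)
  case (insert x A)
  have "prod f (insert x A) - prod g (insert x A) = (f x - g x) * prod f A + g x * (prod f A - prod g A)"
    using insert by (simp add: algebra_simps)
  then show ?case
    using insert by simp
qed simp_all

text \<open>Modulo \<open>Var i0\<close> every modified factor is the original power of its
  variable; the common factor \<open>Var i0 ^ Poly_Mapping.lookup a i0\<close> raises this
  congruence to the stated power. It is the source of the triangularity in the count.\<close>

lemma lead_lift_leading_term:
  fixes i0 :: "'n::finite"
  assumes a: "a \<in> leading_exponents i0 L p e q d" and "1 < p"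
  shows "Var i0 ^ (Poly_Mapping.lookup a i0 + 1) dvd
    lead_lift i0 L p q a - (Poly_Mapping.single a 1 :: ('n, 'k::comm_ring_1) mpol)"
proof (cases "Poly_Mapping.lookup a i0 = q - 1")
  case False
  let ?N = "\<lambda>i. if i \<in> L then (Var i ^ p - Var i * Var i0 ^ (p - 1)) ^ (Poly_Mapping.lookup a i div p)
      else (Var i ^ Poly_Mapping.lookup a i :: ('n, 'k) mpol)"
  have "Var i0 dvd ?N i - Var i ^ Poly_Mapping.lookup a i" for i
    using a False Var_dvd_norm_power_diff[OF assms(2), of "Poly_Mapping.lookup a i" i0 i]
    by (auto simp: leading_exponents_def)
  then have "Var i0 dvd prod ?N (UNIV - {i0}) - (\<Prod>i\<in>UNIV - {i0}. Var i ^ Poly_Mapping.lookup a i)"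
    by (intro dvd_prod_diff)
  then have "Var i0 ^ Poly_Mapping.lookup a i0 * Var i0 dvd Var i0 ^ Poly_Mapping.lookup a i0 *
     (prod ?N (UNIV - {i0}) - (\<Prod>i\<in>UNIV - {i0}. Var i ^ Poly_Mapping.lookup a i))"
    by (rule mult_dvd_mono[OF dvd_refl])
  moreover have "lead_lift i0 L p q a - (Poly_Mapping.single a 1 :: ('n, 'k) mpol) = Var i0 ^ Poly_Mapping.lookup a i0 *
     (prod ?N (UNIV - {i0}) - (\<Prod>i\<in>UNIV - {i0}. Var i ^ Poly_Mapping.lookup a i))"
    unfolding lead_lift_def if_not_P[OF False] single_eq_monomial single_split_variable[of _ _ i0]
    by (simp add: algebra_simps)
  ultimately show ?thesis
    by (simp only: power_add power_one_right)
qed (simp add: lead_lift_def)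

lemma lookup_lead_lift:
  assumes "a \<in> leading_exponents i0 L p e q d" and "1 < p" and "Poly_Mapping.lookup b i0 \<le> Poly_Mapping.lookup a i0"
  shows "Poly_Mapping.lookup (lead_lift i0 L p q a) b = (if b = a then 1 else 0)"
  using lookup_eq_0_if_Var_power_dvd[OF lead_lift_leading_term[OF assms(1,2)], of b] assms(3)
  by (auto simp: lookup_minus lookup_single when_def)

text \<open>Applied to the scaling factors, this makes \<open>Var i0 ^ (q - 1)\<close> invariant and
  shows that \<open>e\<close> divides \<open>p ^ m - 1\<close>.\<close>

lemma finite_field_power_card_power_minus_1:
  fixes x :: "'k::finite_field"
  assumes "x \<noteq> 0"
  shows "x ^ (CARD('k) ^ m - 1) = 1"
proof -
  have "x * x ^ (CARD('k) ^ m - 1) = x ^ (CARD('k) ^ m)"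
    by (simp flip: power_Suc)
  also have "\<dots> = x"
    by (simp add: finite_field_power_card_power_eq_same)
  finally show ?thesis
    using assms by simp
qed

text \<open>For the exponent \<open>q - 1\<close>, the power of \<open>?z\<close> is fixed and the
  remaining factors change by multiples of \<open>?z\<close>, so the total change is a multiple of
  \<open>?z ^ q\<close>. For smaller exponents the lift is invariant in the polynomial ring
  itself.\<close>

lemma lead_lift_invariant:
  fixes u :: "'p::prime_card mod_ring"
  assumes "i0 \<notin> L" and U: "U = range (\<lambda>k::nat. u ^ k)" and e: "\<And>j. u ^ j = 1 \<longleftrightarrow> e dvd j"
    and q: "q = CARD('p) ^ m" and "u \<noteq> 0"
    and a: "a \<in> leading_exponents i0 L CARD('p) e q d"
    and A: "A \<in> normal_form i0 L U"
  shows "linear_subst A (lead_lift i0 L CARD('p) q a) - lead_lift i0 L CARD('p) q a \<in> power_ideal q"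
proof -
  let ?p = "CARD('p)"
  let ?z = "Var i0 :: ('a, 'p mod_ring) mpol"
  have p: "prime ?p"
    by (rule prime_card)
  obtain c k where c: "\<And>i. i \<notin> insert i0 L \<Longrightarrow> c $ i = 0" "1 + c $ i0 = u ^ k" and "A = axis_matrix i0 c"
    using A by (auto simp: normal_form_def U)
  define \<phi> where "\<phi> i = Var i + Const (c $ i) * ?z" for i
  have A: "linear_subst A = subst \<phi>"
    by (simp add: fun_eq_iff \<open>A = _\<close> linear_subst_axis_matrix \<phi>_def[abs_def])
  have \<phi>z: "\<phi> i0 = Const (u ^ k) * ?z"
    unfolding c(2)[symmetric] \<phi>_def by (simp add: Const_add algebra_simps)
  have \<phi>c: "\<phi> i = Var i" if "i \<notin> insert i0 L" for i
    using c(1)[OF that] by (simp add: \<phi>_def)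
  show ?thesis
  proof (cases "Poly_Mapping.lookup a i0 = q - 1")
    case True
    have "(u ^ k) ^ (q - 1) = 1"
      using finite_field_power_card_power_minus_1[of "u ^ k" m] assms(5) by (simp add: q)
    then have 1: "\<phi> i0 ^ Poly_Mapping.lookup a i0 = ?z ^ (q - 1)"
      by (simp add: \<phi>z True power_mult_distrib flip: Const_power)
    have "?z dvd \<phi> i ^ Poly_Mapping.lookup a i - Var i ^ Poly_Mapping.lookup a i" for i
      by (simp add: \<phi>_def power_diff_sumr2)
    then have "?z dvd (\<Prod>i\<in>UNIV - {i0}. \<phi> i ^ Poly_Mapping.lookup a i) - (\<Prod>i\<in>UNIV - {i0}. Var i ^ Poly_Mapping.lookup a i)"
      by (intro dvd_prod_diff)
    then have "?z ^ (q - 1) * ?z dvd ?z ^ (q - 1) *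
      ((\<Prod>i\<in>UNIV - {i0}. \<phi> i ^ Poly_Mapping.lookup a i) - (\<Prod>i\<in>UNIV - {i0}. Var i ^ Poly_Mapping.lookup a i))"
      by (rule mult_dvd_mono[OF dvd_refl])
    also have "\<dots> = subst \<phi> (Poly_Mapping.single a 1) - Poly_Mapping.single a 1"
      unfolding subst_single unfolding single_eq_monomial single_split_variable[of _ _ i0] 1
      by (simp add: True algebra_simps)
    finally have "?z ^ (q - 1) * ?z dvd \<dots>" .
    moreover have "?z ^ (q - 1) * ?z = ?z ^ q"
      using prime_gt_0_nat[OF p] by (simp add: q mult.commute flip: power_Suc)
    ultimately show ?thesis
      using power_ideal_dvd[OF Var_power_in_power_ideal] by (simp add: A lead_lift_def True)
  next
    case False
    let ?N = "\<lambda>i. if i \<in> L then (Var i ^ ?p - Var i * ?z ^ (?p - 1)) ^ (Poly_Mapping.lookup a i div ?p)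
      else Var i ^ Poly_Mapping.lookup a i"
    \<comment> \<open>Over the prime field the \<open>?p\<close>-th power of \<open>c $ i\<close> is
      \<open>c $ i\<close>, and the scaling fixes \<open>?z ^ (?p - 1)\<close>; so both terms on the
      left gain \<open>Const (c $ i) * ?z ^ ?p\<close>, which cancels.\<close>
    have N: "\<phi> i ^ ?p - \<phi> i * \<phi> i0 ^ (?p - 1) = Var i ^ ?p - Var i * ?z ^ (?p - 1)" for i
    proof -
      have "\<phi> i ^ ?p = Var i ^ ?p + (Const (c $ i) * ?z) ^ ?p"
        unfolding \<phi>_def by (rule freshmans_dream) (simp_all add: CHAR_mpol p)
      also have "(Const (c $ i) * ?z) ^ ?p = Const (c $ i) * ?z ^ ?p"
        using finite_field_power_card_eq_same[of "c $ i"] by (simp add: power_mult_distrib flip: Const_power)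
      finally have "\<phi> i ^ ?p = Var i ^ ?p + Const (c $ i) * ?z ^ ?p" .
      moreover have "\<phi> i0 ^ (?p - 1) = ?z ^ (?p - 1)"
        using finite_field_power_card_power_minus_1[of "u ^ k" 1] assms(5) by (simp add: \<phi>z power_mult_distrib flip: Const_power)
      moreover have "?z ^ ?p = ?z * ?z ^ (?p - 1)"
        using prime_gt_0_nat[OF p] by (simp flip: power_Suc)
      then have "\<phi> i * ?z ^ (?p - 1) = Var i * ?z ^ (?p - 1) + Const (c $ i) * ?z ^ ?p"
        by (simp only: \<phi>_def distrib_right mult.assoc)
      ultimately show ?thesis
        by (simp only: add_diff_cancel_right)
    qed
    have "e dvd Poly_Mapping.lookup a i0"
      using a False by (simp add: leading_exponents_def)
    then have "(u ^ k) ^ Poly_Mapping.lookup a i0 = 1"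
      by (metis e mult.commute power_mult power_one)
    then have "\<phi> i0 ^ Poly_Mapping.lookup a i0 = ?z ^ Poly_Mapping.lookup a i0"
      by (simp add: \<phi>z power_mult_distrib flip: Const_power)
    moreover have "subst \<phi> (prod ?N (UNIV - {i0})) = prod ?N (UNIV - {i0})"
      unfolding subst_prod
      by (rule prod.cong) (auto simp add: subst_power subst_diff subst_mult N[unfolded One_nat_def] \<phi>c)
    ultimately have "subst \<phi> (lead_lift i0 L ?p q a) = lead_lift i0 L ?p q a"
      unfolding lead_lift_def if_not_P[OF False] subst_mult subst_power subst_Var by (simp only:)
    then show ?thesis
      by (simp add: A power_ideal_0)
  qed
qed

section \<open>The number of invariant classes\<close>

lemma finite_leading_exponents: "finite (leading_exponents i0 L p e q d)"
proof (rule finite_imageD)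
  have "Poly_Mapping.lookup ` leading_exponents i0 L p e q d \<subseteq> (\<Pi>\<^sub>E i\<in>UNIV. {..<q})"
    by (auto simp: leading_exponents_def)
  then show "finite (Poly_Mapping.lookup ` leading_exponents i0 L p e q d)"
    by (rule finite_subset) (simp add: finite_PiE)
  show "inj_on Poly_Mapping.lookup (leading_exponents i0 L p e q d)"
    by (auto intro: inj_onI poly_mapping_eqI)
qed

text \<open>The assignment of \<open>g x\<close> to \<open>f x\<close> is well defined and
  injective. It lets classes be counted through a vector of coefficients.\<close>

lemma card_image_eq_if_same_kernel:
  assumes "\<And>x y. x \<in> T \<Longrightarrow> y \<in> T \<Longrightarrow> f x = f y \<longleftrightarrow> g x = g y"
  shows "card (f ` T) = card (g ` T)"
proof (rule bij_betw_same_card)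
  let ?h = "\<lambda>X. g (inv_into T f X)"
  have "?h (f x) = g x" if "x \<in> T" for x
    using assms[of "inv_into T f (f x)" x] that by (simp add: inv_into_into f_inv_into_f)
  then show "bij_betw ?h (f ` T) (g ` T)"
    using assms by (auto simp: bij_betw_def inj_on_def image_image)
qed

text \<open>The map \<open>\<rho>\<close> keeps the coefficients at leading exponents. It separates
  the classes, since a difference of invariants with all these coefficients zero lies in the ideal;
  and it reaches every vector of coefficients, already on the combinations \<open>\<Phi> c\<close>
  of lifts.\<close>

lemma card_normal_form_invariants:
  fixes u :: "'p::prime_card mod_ring" and i0 :: "'n::finite"
  assumes "i0 \<notin> L" and U: "U = range (\<lambda>k::nat. u ^ k)" and e: "\<And>j. u ^ j = 1 \<longleftrightarrow> e dvd j"
    and q: "q = CARD('p) ^ m" and "u \<noteq> 0"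
  shows "card ((+>\<^bsub>mpol_ring\<^esub>) (power_ideal q) ` invariants_mod (normal_form i0 L U) q d) =
    CARD('p) ^ card (leading_exponents i0 L CARD('p) e q d)"
proof -
  let ?B = "leading_exponents i0 L CARD('p) e q d"
  let ?T = "invariants_mod (normal_form i0 L U) q d"
  let ?b = "lead_lift i0 L CARD('p) q :: _ \<Rightarrow> ('n, 'p mod_ring) mpol"
  define \<rho> :: "('n, 'p mod_ring) mpol \<Rightarrow> _" where "\<rho> f = restrict (Poly_Mapping.lookup f) ?B" for f
  have p: "prime CARD('p)"
    by (rule prime_card)
  interpret T: subalgebra "range Const" ?T mpol_ring
    by (rule subalgebra_invariants_mod)
  have Tdiff: "f - g \<in> ?T" if "f \<in> ?T" "g \<in> ?T" for f g
    using T.m_closed[OF that(1) T.m_inv_closed[OF that(2)]]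
    unfolding a_inv_def[symmetric] by simp
  have Tsum: "sum h S \<in> ?T" if "\<And>x. x \<in> S \<Longrightarrow> h x \<in> ?T" for h and S :: "('n \<Rightarrow>\<^sub>0 nat) set"
    using that T.m_closed T.one_closed by (induction S rule: infinite_finite_induct) auto
  have Bred: "\<forall>i. Poly_Mapping.lookup a i < q" if "a \<in> ?B" for a
    using that by (simp add: leading_exponents_def)
  have kernel: "power_ideal q +>\<^bsub>mpol_ring\<^esub> f = power_ideal q +>\<^bsub>mpol_ring\<^esub> g \<longleftrightarrow> \<rho> f = \<rho> g"
    if "f \<in> ?T" "g \<in> ?T" for f g
  proof -
    have "f - g \<in> power_ideal q \<longleftrightarrow> (\<forall>a\<in>?B. Poly_Mapping.lookup (f - g) a = 0)"
      using normal_form_lookup_leading_exponents[OF assms(1-4) Tdiff[OF that]]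
        lookup_eq_0_if_power_ideal[of "f - g" q] Bred by blast
    then show ?thesis
      by (auto simp: coset_eq_iff \<rho>_def lookup_minus fun_eq_iff restrict_def)
  qed
  define \<Phi> where "\<Phi> c = (\<Sum>a\<in>?B. Const (c a) * ?b a)" for c
  have bT: "?b a \<in> ?T" if "a \<in> ?B" for a
    using homogeneous_lead_lift[OF that] lead_lift_invariant[OF assms that] prime_gt_0_nat[OF p]
    by (simp add: invariants_mod_def)
  have "\<Phi> c \<in> ?T" for c
    unfolding \<Phi>_def using T.smult_closed[OF _ bT] by (intro Tsum) simp
  then have sub: "\<rho> ` \<Phi> ` (?B \<rightarrow>\<^sub>E UNIV) \<subseteq> \<rho> ` ?T"
    by auto
  \<comment> \<open>The coefficient matrix of the lifts is unitriangular for the degree in \<open>Var i0\<close>.\<close>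
  have "inj_on (\<lambda>c. \<rho> (\<Phi> c)) (?B \<rightarrow>\<^sub>E UNIV)"
  proof (rule inj_onI, rule ccontr)
    fix c c' assume c: "c \<in> ?B \<rightarrow>\<^sub>E UNIV" "c' \<in> ?B \<rightarrow>\<^sub>E UNIV" and eq: "\<rho> (\<Phi> c) = \<rho> (\<Phi> c')" and "c \<noteq> c'"
    from c \<open>c \<noteq> c'\<close> obtain a0 where "a0 \<in> ?B \<and> c a0 \<noteq> c' a0"
      by (meson PiE_ext)
    then obtain a where a: "a \<in> ?B" "c a \<noteq> c' a"
      and min: "\<And>b. b \<in> ?B \<Longrightarrow> c b \<noteq> c' b \<Longrightarrow> Poly_Mapping.lookup a i0 \<le> Poly_Mapping.lookup b i0"
      using ex_has_least_nat[of "\<lambda>a. a \<in> ?B \<and> c a \<noteq> c' a" a0 "\<lambda>a. Poly_Mapping.lookup a i0"] by blast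
    \<comment> \<open>If \<open>c b\<close> and \<open>c' b\<close> differ, minimality of
      \<open>a\<close> puts it in the range of degrees in \<open>Var i0\<close> where the lift of
      \<open>b\<close> has no coefficient except the 1 at \<open>b\<close>.\<close>
    have "(c b - c' b) * Poly_Mapping.lookup (?b b) a = (if b = a then c a - c' a else 0)" if "b \<in> ?B" for b
      using lookup_lead_lift[OF that prime_gt_1_nat[OF p], of a] min[OF that] by (cases "c b = c' b") auto
    then have "(\<Sum>b\<in>?B. (c b - c' b) * Poly_Mapping.lookup (?b b) a) = c a - c' a"
      using a(1) by (simp add: finite_leading_exponents)
    moreover have "(\<Sum>b\<in>?B. (c b - c' b) * Poly_Mapping.lookup (?b b) a) =
        Poly_Mapping.lookup (\<Phi> c) a - Poly_Mapping.lookup (\<Phi> c') a"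
      by (simp add: \<Phi>_def lookup_sum lookup_Const_mult algebra_simps sum_subtractf)
    moreover have "Poly_Mapping.lookup (\<Phi> c) a = Poly_Mapping.lookup (\<Phi> c') a"
      using fun_cong[OF eq, of a] a(1) by (simp add: \<rho>_def)
    ultimately show False
      using a(2) by simp
  qed
  moreover have fin: "finite (?B \<rightarrow>\<^sub>E (UNIV :: 'p mod_ring set))"
    by (simp add: finite_PiE finite_leading_exponents)
  moreover have "(\<lambda>c. \<rho> (\<Phi> c)) ` (?B \<rightarrow>\<^sub>E UNIV) \<subseteq> ?B \<rightarrow>\<^sub>E UNIV"
    by (auto simp: \<rho>_def)
  \<comment> \<open>An injective map of a finite set to itself is onto, so the triangular system is
    solved without inverting it.\<close>
  ultimately have "(\<lambda>c. \<rho> (\<Phi> c)) ` (?B \<rightarrow>\<^sub>E UNIV) = ?B \<rightarrow>\<^sub>E UNIV"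
    by (metis endo_inj_surj)
  with sub have "\<rho> ` ?T = ?B \<rightarrow>\<^sub>E UNIV"
    by (auto simp: \<rho>_def image_image)
  then have "card (\<rho> ` ?T) = CARD('p) ^ card ?B"
    by (simp add: card_PiE finite_leading_exponents)
  moreover have "card ((+>\<^bsub>mpol_ring\<^esub>) (power_ideal q) ` ?T) = card (\<rho> ` ?T)"
    using kernel by (rule card_image_eq_if_same_kernel)
  ultimately show ?thesis
    by simp
qed

section \<open>Counting the leading exponents\<close>

lemma fps_geometric_sum: "(\<Sum>j<k. fps_X ^ (r * j)) * (1 - fps_X ^ r) = (1 - fps_X ^ (r * k) :: rat fps)"
proof -
  have "(\<Sum>j<k. fps_X ^ (r * j)) * (1 - fps_X ^ r) = (1 - fps_X ^ r) * (\<Sum>j<k. (fps_X ^ r) ^ j :: rat fps)"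
    unfolding power_mult by (rule mult.commute)
  also have "\<dots> = 1 - (fps_X ^ r) ^ k"
    by (rule one_diff_power_eq[symmetric])
  finally show ?thesis
    by (simp add: power_mult)
qed

lemma fps_nth_0_one_minus_X_power [simp]: "0 < r \<Longrightarrow> fps_nth (1 - fps_X ^ r :: rat fps) 0 = 1"
  by (simp add: fps_X_power_nth)

text \<open>In general \<open>/\<close> on \<open>fps\<close> shifts by the subdegree of the divisor
  and truncates; a nonzero constant term makes it an exact quotient.\<close>

lemma fps_divide_eq_iff_unit:
  fixes f g h :: "rat fps"
  assumes "fps_nth g 0 \<noteq> 0"
  shows "f / g = h \<longleftrightarrow> f = h * g"
  using assms by (metis fps_divide_times_eq fps_divide_unit fps_is_unit_iff fps_nonzero_nth nonzero_mult_div_cancel_right unit_div_mult_self)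

lemma sum_multiples_eq:
  assumes "0 < r"
  shows "(\<Sum>j\<in>{j. j < r * k \<and> r dvd j}. fps_X ^ j) = (1 - fps_X ^ (r * k)) / (1 - fps_X ^ r :: rat fps)"
proof -
  have "{j. j < r * k \<and> r dvd j} = (\<lambda>j. r * j) ` {..<k}"
    using assms by (auto elim!: dvdE)
  then have "(\<Sum>j\<in>{j. j < r * k \<and> r dvd j}. fps_X ^ j) = (\<Sum>j<k. fps_X ^ (r * j) :: rat fps)"
    using assms by (simp add: sum.reindex inj_on_def)
  then show ?thesis
    using fps_geometric_sum[of r k] assms fps_divide_eq_iff_unit[of "1 - fps_X ^ r" "1 - fps_X ^ (r * k)"]
    by (metis fps_nth_0_one_minus_X_power zero_neq_one)
qed

text \<open>The total degree is additive over the variables, so expanding the product by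
  distributivity runs through the exponent vectors of the box.\<close>

lemma sum_box_eq_prod:
  assumes "\<And>i. finite (S i)"
  shows "(\<Sum>a\<in>{a :: 'n::finite \<Rightarrow>\<^sub>0 nat. \<forall>i. Poly_Mapping.lookup a i \<in> S i}. fps_X ^ (\<Sum>i\<in>UNIV. Poly_Mapping.lookup a i)) =
    (\<Prod>i\<in>UNIV. \<Sum>j\<in>S i. fps_X ^ j :: rat fps)"
proof -
  have "(\<Prod>i\<in>UNIV. \<Sum>j\<in>S i. fps_X ^ j :: rat fps) = (\<Sum>g\<in>PiE UNIV S. \<Prod>i\<in>UNIV. fps_X ^ g i)"
    using assms by (intro prod_sum_PiE) auto
  also have "\<dots> = (\<Sum>g\<in>PiE UNIV S. fps_X ^ (\<Sum>i\<in>UNIV. g i))"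
    by (simp add: power_sum)
  also have "\<dots> = (\<Sum>a\<in>{a :: 'n \<Rightarrow>\<^sub>0 nat. \<forall>i. Poly_Mapping.lookup a i \<in> S i}. fps_X ^ (\<Sum>i\<in>UNIV. Poly_Mapping.lookup a i))"
    by (rule sum.reindex_bij_witness[of _ Poly_Mapping.lookup Abs_poly_mapping]) (auto simp: PiE_def)
  finally show ?thesis ..
qed

lemma Abs_fps_card_eq_sum:
  fixes w :: "'b \<Rightarrow> nat"
  assumes "finite A"
  shows "Abs_fps (\<lambda>d. of_nat (card {a \<in> A. w a = d})) = (\<Sum>a\<in>A. fps_X ^ w a :: rat fps)"
proof (rule fps_ext)
  fix d
  have "fps_nth (\<Sum>a\<in>A. fps_X ^ w a :: rat fps) d = (\<Sum>a\<in>A. if w a = d then 1 else 0)"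
    by (auto simp: fps_sum_nth fps_X_power_nth intro: sum.cong)
  also have "\<dots> = of_nat (card {a \<in> A. w a = d})"
    using assms by (simp flip: sum.inter_filter)
  finally show "fps_nth (Abs_fps (\<lambda>d. of_nat (card {a \<in> A. w a = d}))) d = fps_nth (\<Sum>a\<in>A. fps_X ^ w a :: rat fps) d"
    by simp
qed

lemma prod_split_three:
  fixes h :: "'n::finite \<Rightarrow> 'a::comm_monoid_mult"
  assumes "i0 \<notin> L" "\<And>i. i \<in> L \<Longrightarrow> h i = x" "\<And>i. i \<notin> L \<Longrightarrow> i \<noteq> i0 \<Longrightarrow> h i = y"
  shows "prod h UNIV = y ^ (CARD('n) - card L - 1) * x ^ card L * h i0"
proof -
  have "prod h UNIV = prod h (UNIV - insert i0 L) * prod h (insert i0 L)"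
    by (rule prod.subset_diff) auto
  also have "prod h (UNIV - insert i0 L) = y ^ card (UNIV - insert i0 L)"
    using assms(3) by (simp add: prod.cong[of _ _ h "\<lambda>_. y"])
  also have "card (UNIV - insert i0 L) = CARD('n) - card L - 1"
    using assms(1) by (simp add: card_Diff_subset)
  also have "prod h (insert i0 L) = h i0 * x ^ card L"
    using assms(1,2) by (simp add: prod.cong[of _ _ h "\<lambda>_. x"])
  finally show ?thesis
    by (simp add: ac_simps)
qed

text \<open>The exponents form two disjoint boxes, according to whether the exponent of
  \<open>i0\<close> is \<open>q - 1\<close>. The generating function of a box is a product of
  geometric sums, which end at the right place because \<open>p\<close> divides \<open>q\<close> and
  \<open>e\<close> divides \<open>q - 1\<close>.\<close>

lemma leading_exponents_series:
  fixes i0 :: "'n::finite" and t :: "rat fps"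
  assumes "i0 \<notin> L" and "0 < p" and "0 < m" and q: "q = p ^ m" and "0 < e" and e: "e dvd q - 1"
    and t: "t = fps_X"
  shows "Abs_fps (\<lambda>d. of_nat (card (leading_exponents i0 L p e q d))) =
    ((1 - t ^ q) / (1 - t)) ^ (CARD('n) - card L - 1) * ((1 - t ^ q) / (1 - t ^ p)) ^ card L *
      ((1 - t ^ (q - 1)) / (1 - t ^ e)) + t ^ (q - 1) * ((1 - t ^ q) / (1 - t)) ^ (CARD('n) - 1)"
proof -
  define box where "box S = {a :: 'n \<Rightarrow>\<^sub>0 nat. \<forall>i. Poly_Mapping.lookup a i \<in> S i}" for S
  \<comment> \<open>The value \<open>q - 1\<close> is itself a multiple of \<open>e\<close>; it is
    left to \<open>S'\<close> so that no exponent is counted twice.\<close>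
  define S where "S i = (if i = i0 then {j. j < q - 1 \<and> e dvd j} else if i \<in> L then {j. j < q \<and> p dvd j}
      else {..<q})" for i
  define S' where "S' i = (if i = i0 then {q - 1} else {..<q})" for i
  let ?deg = "\<lambda>a :: 'n \<Rightarrow>\<^sub>0 nat. \<Sum>i\<in>UNIV. Poly_Mapping.lookup a i"
  have q0: "0 < q"
    using assms by simp
  \<comment> \<open>Here \<open>0 < m\<close> enters: the multiples of \<open>p\<close> below
    \<open>q\<close> are those by factors less than \<open>p ^ (m - 1)\<close>.\<close>
  have pm: "p * p ^ (m - 1) = q"
    using assms(3) by (simp add: q flip: power_Suc)
  have fin_box: "finite (box R)" if "\<And>i. finite (R i)" for R
  proof (rule finite_imageD)
    have "Poly_Mapping.lookup ` box R \<subseteq> PiE UNIV R"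
      by (auto simp: box_def)
    then show "finite (Poly_Mapping.lookup ` box R)"
      by (rule finite_subset) (simp add: finite_PiE that)
    show "inj_on Poly_Mapping.lookup (box R)"
      by (auto intro: inj_onI poly_mapping_eqI)
  qed
  have finS: "finite (S i)" "finite (S' i)" for i
    by (auto simp: S_def S'_def)
  have "leading_exponents i0 L p e q d = {a \<in> box S \<union> box S'. ?deg a = d}" for d
  proof (rule Set.set_eqI)
    fix a :: "'n \<Rightarrow>\<^sub>0 nat"
    have "a \<in> box S \<longleftrightarrow> (\<forall>i. Poly_Mapping.lookup a i < q) \<and> Poly_Mapping.lookup a i0 \<noteq> q - 1 \<and>
        e dvd Poly_Mapping.lookup a i0 \<and> (\<forall>i\<in>L. p dvd Poly_Mapping.lookup a i)"
    proof -
      have "j < q - 1 \<longleftrightarrow> j < q \<and> j \<noteq> q - 1" for j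
        using q0 by linarith
      then have "Poly_Mapping.lookup a i \<in> S i \<longleftrightarrow> Poly_Mapping.lookup a i < q \<and>
          (i = i0 \<longrightarrow> Poly_Mapping.lookup a i \<noteq> q - 1 \<and> e dvd Poly_Mapping.lookup a i) \<and>
          (i \<in> L \<longrightarrow> p dvd Poly_Mapping.lookup a i)" for i
        using assms(1) by (cases "i = i0") (simp_all add: S_def)
      then show ?thesis
        unfolding box_def by blast
    qed
    moreover have "a \<in> box S' \<longleftrightarrow> (\<forall>i. Poly_Mapping.lookup a i < q) \<and> Poly_Mapping.lookup a i0 = q - 1"
    proof -
      have "Poly_Mapping.lookup a i \<in> S' i \<longleftrightarrow>
          Poly_Mapping.lookup a i < q \<and> (i = i0 \<longrightarrow> Poly_Mapping.lookup a i = q - 1)" for i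
        using q0 by (auto simp: S'_def)
      then show ?thesis
        unfolding box_def by blast
    qed
    ultimately show "a \<in> leading_exponents i0 L p e q d \<longleftrightarrow> a \<in> {a \<in> box S \<union> box S'. ?deg a = d}"
      unfolding leading_exponents_def by blast
  qed
  then have "Abs_fps (\<lambda>d. of_nat (card (leading_exponents i0 L p e q d))) =
      (\<Sum>a\<in>box S \<union> box S'. fps_X ^ ?deg a :: rat fps)"
    using Abs_fps_card_eq_sum[of "box S \<union> box S'" ?deg] fin_box finS by simp
  also have "\<dots> = (\<Sum>a\<in>box S. fps_X ^ ?deg a) + (\<Sum>a\<in>box S'. fps_X ^ ?deg a)"
  proof (rule sum.union_disjoint)
    show "box S \<inter> box S' = {}"
    proof -
      have "S i0 \<inter> S' i0 = {}"
        by (auto simp: S_def S'_def)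
      then show ?thesis
        unfolding box_def by blast
    qed
  qed (use fin_box finS in auto)
  also have "\<dots> = (\<Prod>i\<in>UNIV. \<Sum>j\<in>S i. t ^ j) + (\<Prod>i\<in>UNIV. \<Sum>j\<in>S' i. t ^ j)"
    unfolding box_def t using finS by (simp only: sum_box_eq_prod)
  also have "(\<Prod>i\<in>UNIV. \<Sum>j\<in>S i. t ^ j) =
      (\<Sum>j<q. t ^ j) ^ (CARD('n) - card L - 1) * (\<Sum>j\<in>{j. j < q \<and> p dvd j}. t ^ j) ^ card L * (\<Sum>j\<in>S i0. t ^ j)"
    using assms(1) by (intro prod_split_three) (auto simp: S_def)
  also have "(\<Prod>i\<in>UNIV. \<Sum>j\<in>S' i. t ^ j) = (\<Sum>j<q. t ^ j) ^ (CARD('n) - 1) * t ^ (q - 1)"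
    using prod_split_three[of i0 "{}" "\<lambda>i. \<Sum>j\<in>S' i. t ^ j" 1 "\<Sum>j<q. t ^ j"] by (simp add: S'_def)
  also have "(\<Sum>j<q. t ^ j) = (1 - t ^ q) / (1 - t)"
    using sum_multiples_eq[of 1 q] by (simp add: t lessThan_def)
  also have "(\<Sum>j\<in>{j. j < q \<and> p dvd j}. t ^ j) = (1 - t ^ q) / (1 - t ^ p)"
    using sum_multiples_eq[of p "p ^ (m - 1)"] assms(2) pm by (simp add: t)
  also have "(\<Sum>j\<in>S i0. t ^ j) = (1 - t ^ (q - 1)) / (1 - t ^ e)"
    using sum_multiples_eq[of e "(q - 1) div e"] assms(5) e by (simp add: t S_def)
  finally show ?thesis
    by (simp add: mult.commute)
qed

section \<open>Groups fixing a hyperplane pointwise\<close>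

text \<open>The field type is repackaged as a record \<open>F\<close> so that the existence of a
  generator of \<open>mult_of F\<close> applies to it.\<close>

lemma finite_field_primitive_root:
  "\<exists>\<gamma> :: 'k::finite_field. \<gamma> \<noteq> 0 \<and> (\<forall>x. x \<noteq> 0 \<longrightarrow> (\<exists>i::nat. x = \<gamma> ^ i))"
proof -
  define F :: "'k ring" where
    "F = \<lparr>carrier = UNIV, monoid.mult = (*), one = 1, zero = 0, add = (+)\<rparr>"
  have "cring F"
  proof (rule cringI)
    show "abelian_group F"
    proof (rule abelian_groupI)
      fix x :: 'k
      show "\<exists>y \<in> carrier F. y \<oplus>\<^bsub>F\<^esub> x = \<zero>\<^bsub>F\<^esub>"
        by (auto simp: F_def intro!: exI[of _ "- x"])
    qed (auto simp: F_def ac_simps)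
    show "comm_monoid F"
      by (rule comm_monoidI) (auto simp: F_def ac_simps)
  qed (auto simp: F_def algebra_simps)
  then interpret F: cring F .
  interpret F: field F
  proof (rule F.cring_fieldI)
    show "Units F = carrier F - {\<zero>\<^bsub>F\<^esub>}"
    proof (intro equalityI subsetI)
      fix x assume "x \<in> carrier F - {\<zero>\<^bsub>F\<^esub>}"
      then show "x \<in> Units F"
        by (auto simp: F_def Units_def intro!: exI[of _ "inverse x"])
    qed (auto simp: F_def Units_def)
  qed
  have pow: "x [^]\<^bsub>F\<^esub> i = x ^ i" for x and i :: nat
    by (induction i) (simp_all add: F_def nat_pow_def)
  obtain \<gamma> where "\<gamma> \<in> carrier (mult_of F)"
    and "carrier (mult_of F) = {\<gamma> [^]\<^bsub>F\<^esub> i | i::nat. i \<in> UNIV}"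
    by (rule bexE[OF F.finite_field_mult_group_has_gen[OF finite]])
  then show ?thesis
    unfolding pow by (intro exI[of _ \<gamma>]) (auto simp: F_def carrier_mult_of)
qed

text \<open>As for subgroups of a cyclic group, division with remainder by the least positive
  exponent \<open>d\<close> with \<open>\<gamma> ^ d\<close> in \<open>U\<close> shows that
  \<open>d\<close> divides all exponents occurring. Inverses are powers, because nonzero elements
  have finite order.\<close>

lemma finite_field_submonoid_cyclic:
  fixes U :: "'k::finite_field set"
  assumes "1 \<in> U" "0 \<notin> U" and mult: "\<And>x y. x \<in> U \<Longrightarrow> y \<in> U \<Longrightarrow> x * y \<in> U"
  obtains u where "u \<in> U" "U = range (\<lambda>k::nat. u ^ k)"
proof -
  obtain \<gamma> :: 'k where "\<gamma> \<noteq> 0" and \<gamma>: "\<And>x. x \<noteq> 0 \<Longrightarrow> \<exists>i::nat. x = \<gamma> ^ i"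
    using finite_field_primitive_root by blast
  have card: "1 < CARD('k)"
    using card_mono[of UNIV "{0, 1 :: 'k}"] by simp
  have power: "x ^ k \<in> U" if "x \<in> U" for x and k :: nat
    using that by (induction k) (auto intro: assms)
  have inv: "inverse x \<in> U" if "x \<in> U" for x
  proof -
    have "x \<noteq> 0"
      using that assms(2) by auto
    have "x * x ^ (CARD('k) - 2) = x ^ (CARD('k) ^ 1 - 1)"
      using card by (simp add: numeral_2_eq_2 Suc_diff_Suc flip: power_Suc)
    also have "\<dots> = 1"
      using \<open>x \<noteq> 0\<close> by (rule finite_field_power_card_power_minus_1)
    finally have "inverse x = x ^ (CARD('k) - 2)"
      using \<open>x \<noteq> 0\<close> by (simp add: field_simps)
    then show ?thesis
      using power[OF that] by simp
  qed
  define d where "d = (LEAST i. 0 < i \<and> \<gamma> ^ i \<in> U)"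
  have "0 < CARD('k) ^ 1 - 1 \<and> \<gamma> ^ (CARD('k) ^ 1 - 1) \<in> U"
    using finite_field_power_card_power_minus_1[OF \<open>\<gamma> \<noteq> 0\<close>, of 1] assms(1) card by simp
  then have d: "0 < d" "\<gamma> ^ d \<in> U"
    using LeastI[of "\<lambda>i. 0 < i \<and> \<gamma> ^ i \<in> U"] unfolding d_def by blast+
  have "U = range (\<lambda>k. (\<gamma> ^ d) ^ k)"
  proof (intro equalityI subsetI)
    fix x assume x: "x \<in> U"
    then obtain i where i: "x = \<gamma> ^ i"
      using \<gamma>[of x] assms(2) by blast
    have "x = (\<gamma> ^ d) ^ (i div d) * \<gamma> ^ (i mod d)"
      unfolding i by (simp flip: power_mult power_add)
    then have "\<gamma> ^ (i mod d) = x * inverse ((\<gamma> ^ d) ^ (i div d))"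
      using \<open>\<gamma> \<noteq> 0\<close> by (simp add: field_simps)
    also have "\<dots> \<in> U"
      by (intro mult x inv power d)
    finally have "i mod d = 0"
      using not_less_Least[of "i mod d" "\<lambda>i. 0 < i \<and> \<gamma> ^ i \<in> U"] d(1)
      by (auto simp flip: d_def)
    then show "x \<in> range (\<lambda>k. (\<gamma> ^ d) ^ k)"
      unfolding i by (auto simp flip: power_mult elim!: dvdE simp: mod_eq_0_iff_dvd)
  qed (use power[OF d(2)] in auto)
  then show thesis
    using that d(2) by blast
qed

lemma axis_matrix_mult_vec: "axis_matrix i0 c *v x = x + x $ i0 *s c"
proof (rule vec_eq_iff[THEN iffD2], rule allI)
  fix i
  have "(axis_matrix i0 c *v x) $ i = (\<Sum>j\<in>UNIV. (if j = i then x $ j else 0) + (if j = i0 then c $ i * x $ j else 0))"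
    unfolding matrix_vector_mult_def axis_matrix_def by (auto intro: sum.cong simp: algebra_simps)
  also have "\<dots> = (x + x $ i0 *s c) $ i"
    by (simp add: sum.distrib)
  finally show "(axis_matrix i0 c *v x) $ i = (x + x $ i0 *s c) $ i" .
qed

text \<open>A basis of \<open>W\<close> is extended to a basis of the kernel of \<open>l\<close> and
  completed by \<open>v0\<close>; these vectors are the columns of \<open>B\<close>. As
  \<open>l\<close> is 0 on the former and 1 on \<open>v0\<close>, it becomes the coordinate at the
  index \<open>i0\<close> of \<open>v0\<close>.\<close>

lemma adapted_basis:
  fixes l :: "'k::field ^ 'n \<Rightarrow> 'k"
  assumes lin: "Vector_Spaces.linear (*s) (*) l" and v0: "l v0 = 1"
    and W: "vec.subspace W" "W \<subseteq> {v. l v = 0}"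
  obtains B Q :: "'k ^ 'n ^ 'n" and i0 L where "B ** Q = mat 1" "Q ** B = mat 1" "i0 \<notin> L"
    "card L = vec.dim W" "\<forall>x. l (B *v x) = x $ i0" "B *v axis i0 1 = v0"
    "W = (*v) B ` {x. \<forall>i. i \<notin> L \<longrightarrow> x $ i = 0}"
proof -
  interpret l: Vector_Spaces.linear "(*s)" "(*)" l
    by (rule lin)
  let ?H = "{v. l v = 0}"
  have H: "vec.subspace ?H"
    by (auto simp: vec.subspace_def l.add l.scale l.zero)
  obtain BW where BW: "BW \<subseteq> W" "vec.independent BW" "W \<subseteq> vec.span BW" "card BW = vec.dim W"
    using vec.basis_exists by blast
  obtain BH where BH: "BW \<subseteq> BH" "BH \<subseteq> ?H" "vec.independent BH" "?H \<subseteq> vec.span BH"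
    using vec.maximal_independent_subset_extend[of BW ?H] BW W(2) by blast
  have spanH: "vec.span BH = ?H"
    using BH(2,4) vec.span_minimal[OF _ H] by blast
  then have "v0 \<notin> vec.span BH"
    using v0 by simp
  then have "v0 \<notin> BH" and ind: "vec.independent (insert v0 BH)"
    using BH(3) vec.span_base vec.independent_insertI by blast+
  have "v \<in> vec.span (insert v0 BH)" for v
  proof -
    have "v - l v *s v0 \<in> vec.span BH"
      unfolding spanH by (simp add: l.diff l.scale v0)
    then show ?thesis
      by (auto simp: vec.span_insert)
  qed
  then have "card (insert v0 BH) = CARD('n)"
    using vec.basis_card_eq_dim[of "insert v0 BH" UNIV] ind by (auto simp: vec_dim_card simp del: vec.dim_UNIV)
  moreover have fin: "finite (insert v0 BH)"
    using ind by (rule vec.finiteI_independent)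
  ultimately obtain \<phi> where \<phi>: "bij_betw \<phi> (UNIV :: 'n set) (insert v0 BH)"
    using finite_same_card_bij[of "UNIV :: 'n set" "insert v0 BH"] by auto
  then have inj: "inj \<phi>" and ran: "range \<phi> = insert v0 BH"
    by (auto simp: bij_betw_def)
  have "v0 \<in> range \<phi>"
    by (simp add: ran)
  then obtain i0 where i0: "\<phi> i0 = v0"
    by auto
  define L where "L = \<phi> -` BW"
  have \<phi>L: "\<phi> ` L = BW"
    unfolding L_def using ran BH(1) by auto
  have l\<phi>: "l (\<phi> i) = (if i = i0 then 1 else 0)" for i
  proof (cases "i = i0")
    case False
    then have "\<phi> i \<noteq> v0"
      using i0 inj by (auto dest: injD)
    then have "\<phi> i \<in> BH"
      using rangeI[of \<phi> i] by (simp add: ran)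
    then show ?thesis
      using BH(2) False by auto
  qed (simp add: i0 v0)
  define B where "B = (\<chi> r c. \<phi> c $ r)"
  have B: "B *v x = (\<Sum>i\<in>UNIV. x $ i *s \<phi> i)" for x
    by (simp add: B_def vec_eq_iff matrix_vector_mult_def mult.commute)
  have "\<exists>Q. Q ** B = mat 1"
    unfolding matrix_left_invertible_independent_columns
  proof (intro allI impI)
    fix c i assume "(\<Sum>i\<in>UNIV. c i *s column i B) = 0"
    moreover have "column i B = \<phi> i" for i
      by (simp add: column_def B_def vec_eq_iff)
    ultimately have "(\<Sum>v\<in>insert v0 BH. c (inv_into UNIV \<phi> v) *s v) = 0"
      using sum.reindex[OF inj, of "\<lambda>v. c (inv_into UNIV \<phi> v) *s v"] by (simp add: ran inj o_def)
    then have "c (inv_into UNIV \<phi> (\<phi> i)) = 0"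
      using ind[unfolded vec.independent_explicit, THEN conjunct2, rule_format,
          of "\<lambda>v. c (inv_into UNIV \<phi> v)" "\<phi> i"] ran by blast
    then show "c i = 0"
      by (simp add: inj)
  qed
  then obtain Q where Q: "Q ** B = mat 1"
    by blast
  show thesis
  proof (rule that[of B Q i0 L])
    show "Q ** B = mat 1"
      by (rule Q)
    then show "B ** Q = mat 1"
      by (rule matrix_left_right_inverse1)
    have "v0 \<notin> BW"
      using BW(1) W(2) v0 by auto
    then show "i0 \<notin> L"
      by (simp add: L_def i0)
    show "card L = vec.dim W"
      using card_image[of \<phi> L] inj BW(4) \<phi>L by (simp add: inj_on_subset)
    show "\<forall>x. l (B *v x) = x $ i0"
      by (simp add: B l.sum l.scale l\<phi> if_distrib[of "(*) _"] cong: if_cong)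
    show "B *v axis i0 1 = v0"
      by (simp add: B axis_def i0 if_distrib[of "\<lambda>c. c *s _"] cong: if_cong)
    show "W = (*v) B ` {x. \<forall>i. i \<notin> L \<longrightarrow> x $ i = 0}"
    proof (intro equalityI subsetI)
      fix w assume "w \<in> W"
      moreover have "finite BW"
        using BW(2) by (rule vec.finiteI_independent)
      ultimately obtain c where "w = (\<Sum>v\<in>BW. c v *s v)"
        using BW(3) by (auto simp: vec.span_finite)
      also have "\<dots> = (\<Sum>i\<in>L. c (\<phi> i) *s \<phi> i)"
        using inj unfolding \<phi>L[symmetric] by (subst sum.reindex) (auto simp: inj_on_def)
      also have "\<dots> = B *v (\<chi> i. if i \<in> L then c (\<phi> i) else 0)"
        unfolding B by (rule sum.mono_neutral_cong_left) auto
      finally show "w \<in> (*v) B ` {x. \<forall>i. i \<notin> L \<longrightarrow> x $ i = 0}"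
        by auto
    next
      fix w assume "w \<in> (*v) B ` {x. \<forall>i. i \<notin> L \<longrightarrow> x $ i = 0}"
      then obtain x where x: "\<And>i. i \<notin> L \<Longrightarrow> x $ i = 0" "w = (\<Sum>i\<in>UNIV. x $ i *s \<phi> i)"
        by (auto simp: B)
      have "x $ i *s \<phi> i \<in> W" for i
      proof (cases "i \<in> L")
        case True
        then have "\<phi> i \<in> W"
          using \<phi>L BW(1) by blast
        then show ?thesis
          by (rule vec.subspace_scale[OF W(1)])
      qed (simp add: x vec.subspace_0[OF W(1)])
      then show "w \<in> W"
        unfolding x(2) by (intro vec.subspace_sum W(1))
    qed
  qed
qed

text \<open>The hyperplane is encoded as the kernel of \<open>l\<close>, which
  \<open>nonzero\<close> makes a proper subspace.\<close>

locale hyperplane_group =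
  fixes G :: "('p::prime_card mod_ring ^ 'n ^ 'n) set" and l :: "'p mod_ring ^ 'n \<Rightarrow> 'p mod_ring"
  assumes subgroup: "subgroup G GL"
    and linear: "Vector_Spaces.linear (*s) (*) l"
    and fixed: "\<And>g v. g \<in> G \<Longrightarrow> l v = 0 \<Longrightarrow> g *v v = v"
    and nonzero: "\<exists>v. l v \<noteq> 0"
begin

sublocale l: Vector_Spaces.linear "(*s)" "(*)" l
  by (rule linear)

sublocale GL: group "GL :: ('p mod_ring ^ 'n ^ 'n) monoid"
  by (rule group_GL)

section \<open>Roots and their composition law\<close>

lemma ex_l_eq_1: "\<exists>v. l v = 1"
proof -
  obtain v where "l v \<noteq> 0"
    using nonzero by blast
  then have "l (inverse (l v) *s v) = 1"
    by (simp add: l.scale)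
  then show ?thesis ..
qed

text \<open>The vector \<open>v - l v *s v1\<close> lies in the kernel of \<open>l\<close> and is
  fixed, so \<open>g\<close> is determined by its value at \<open>v1\<close> and has root
  \<open>g *v v1 - v1\<close>.\<close>

lemma ex_root:
  assumes "g \<in> G"
  obtains \<alpha> where "\<alpha> \<in> root_space l G" "\<And>v. g *v v = v + l v *s \<alpha>"
proof -
  obtain v1 where v1: "l v1 = 1"
    using ex_l_eq_1 by blast
  have "g *v v = v + l v *s (g *v v1 - v1)" for v
  proof -
    have "g *v (v - l v *s v1) = v - l v *s v1"
      by (rule fixed[OF assms]) (simp add: l.diff l.scale v1)
    then show ?thesis
      by (simp add: matrix_vector_mult_diff_distrib vec.scale vec.scale_right_diff_distrib algebra_simps)
  qed
  then show thesis
    using that assms unfolding root_space_def by blast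
qed

lemma rootE:
  assumes "\<alpha> \<in> root_space l G"
  obtains g where "g \<in> G" "\<And>v. g *v v = v + l v *s \<alpha>"
  using assms unfolding root_space_def by blast

lemma root_0: "0 \<in> root_space l G"
  using subgroup.one_closed[OF subgroup] by (auto simp: root_space_def GL_def intro!: bexI[of _ "mat 1"])

text \<open>Here \<open>h\<close> acts first and multiplies the value of \<open>l\<close> by
  \<open>1 + l \<beta>\<close>, which weights the root that \<open>g\<close> then adds.\<close>

lemma product_action:
  assumes "\<And>v. g *v v = v + l v *s \<alpha>" "\<And>v. h *v v = v + l v *s \<beta>"
  shows "(g ** h) *v v = v + l v *s (\<beta> + (1 + l \<beta>) *s \<alpha>)"
  by (simp add: assms l.add l.scale algebra_simps vec.scale_right_distrib vec.scale_left_distrib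
      flip: matrix_vector_mul_assoc)

lemma root_mult:
  assumes "\<alpha> \<in> root_space l G" "\<beta> \<in> root_space l G"
  shows "\<beta> + (1 + l \<beta>) *s \<alpha> \<in> root_space l G"
proof -
  obtain g h where gh: "g \<in> G" "\<And>v. g *v v = v + l v *s \<alpha>" "h \<in> G" "\<And>v. h *v v = v + l v *s \<beta>"
    using rootE[OF assms(1)] rootE[OF assms(2)] by metis
  have "g ** h \<in> G"
    using subgroup.m_closed[OF subgroup gh(1,3)] by (simp add: GL_def)
  then show ?thesis
    using product_action[OF gh(2,4)] unfolding root_space_def by blast
qed

text \<open>The root of the inverse solves the composition law with result 0; applying
  \<open>l\<close> to that equation shows that the two factors are inverse to each other.\<close>

lemma root_inverse:
  assumes "\<beta> \<in> root_space l G"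
  obtains \<beta>' where "\<beta>' \<in> root_space l G" "\<beta>' = - ((1 + l \<beta>') *s \<beta>)" "(1 + l \<beta>') * (1 + l \<beta>) = 1"
proof -
  obtain g where g: "g \<in> G" "\<And>v. g *v v = v + l v *s \<beta>"
    using rootE[OF assms] by blast
  let ?h = "inv\<^bsub>GL\<^esub> g"
  have "?h \<in> G"
    using subgroup.m_inv_closed[OF subgroup g(1)] .
  then obtain \<beta>' where \<beta>': "\<beta>' \<in> root_space l G" "\<And>v. ?h *v v = v + l v *s \<beta>'"
    using ex_root by blast
  have "g ** ?h = mat 1"
    using GL.r_inv[of g] subgroup.mem_carrier[OF subgroup g(1)] by (simp add: GL_def)
  then have "v + l v *s (\<beta>' + (1 + l \<beta>') *s \<beta>) = v" for v
    using product_action[OF g(2) \<beta>'(2), of v] by simp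
  moreover obtain v1 where "l v1 = 1"
    using ex_l_eq_1 by blast
  ultimately have 0: "\<beta>' + (1 + l \<beta>') *s \<beta> = 0"
    by (metis add_cancel_left_right vec.scale_one)
  then have "l (\<beta>' + (1 + l \<beta>') *s \<beta>) = 0"
    by (simp only: l.zero)
  then have "(1 + l \<beta>') * (1 + l \<beta>) = 1"
    by (simp add: l.add l.scale algebra_simps)
  with 0 \<beta>'(1) show thesis
    using that by (simp add: eq_neg_iff_add_eq_0)
qed

text \<open>The roots of the transvections in \<open>G\<close>, together with the root 0 of the
  identity.\<close>

definition W where "W = root_space l G \<inter> {v. l v = 0}"

text \<open>The element with root $\alpha$ has determinant $1 + l(\alpha)$.\<close>

definition U where "U = (\<lambda>\<alpha>. 1 + l \<alpha>) ` root_space l G"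

text \<open>On roots with \<open>l \<beta> = 0\<close> the composition law is addition. Closure
  under scalars follows because every element of the prime field is \<open>of_nat k\<close>, so that
  scaling is repeated addition.\<close>

lemma subspace_W: "vec.subspace W"
proof -
  have add: "v + w \<in> W" if "v \<in> W" "w \<in> W" for v w
    using that root_mult[of w v] by (simp add: W_def l.add)
  have 0: "0 \<in> W"
    by (simp add: W_def root_0 l.zero)
  have "of_nat k *s w \<in> W" if "w \<in> W" for k w
    by (induction k) (simp_all add: 0 vec.scale_left_distrib add that)
  then have "c *s w \<in> W" if "w \<in> W" for c w
    using that surj_of_nat_mod_ring[of c] by blast
  with 0 add show ?thesis
    by (simp add: vec.subspace_def)
qed

lemma U_nonzero: "0 \<notin> U"
proof
  assume "0 \<in> U"
  then obtain \<alpha> where \<alpha>: "\<alpha> \<in> root_space l G" "1 + l \<alpha> = 0"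
    by (auto simp: U_def)
  then obtain \<beta>' where "(1 + l \<beta>') * (1 + l \<alpha>) = 1"
    using root_inverse by blast
  with \<alpha>(2) show False
    by simp
qed

text \<open>Applying \<open>1 + l\<close> to the composition law gives the product of the two
  factors, so \<open>U\<close> is a submonoid of the nonzero scalars.\<close>

lemma U_cyclic: obtains u where "u \<in> U" "U = range (\<lambda>k::nat. u ^ k)"
proof (rule finite_field_submonoid_cyclic)
  show "1 \<in> U"
    unfolding U_def using root_0 by (force simp: l.zero)
  show "0 \<notin> U"
    by (rule U_nonzero)
  fix x y assume "x \<in> U" "y \<in> U"
  then obtain \<alpha> \<beta> where "\<alpha> \<in> root_space l G" "\<beta> \<in> root_space l G" and xy: "x = 1 + l \<alpha>" "y = 1 + l \<beta>"
    by (auto simp: U_def)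
  then have "1 + l (\<beta> + (1 + l \<beta>) *s \<alpha>) \<in> U"
    unfolding U_def by (intro imageI root_mult)
  moreover have "1 + l (\<beta> + (1 + l \<beta>) *s \<alpha>) = x * y"
    by (simp add: xy l.add l.scale algebra_simps)
  ultimately show "x * y \<in> U"
    by simp
qed

section \<open>Semisimple elements and their orders\<close>

text \<open>The scalar \<open>s\<close> is the geometric sum of the powers of
  \<open>1 + l \<alpha>\<close> with exponents below \<open>j\<close>. Its value is given in
  multiplied form because \<open>l \<alpha>\<close> may be zero.\<close>

lemma nat_pow_action:
  assumes g: "\<And>v. g *v v = v + l v *s \<alpha>"
  shows "\<exists>s. (\<forall>v. (g [^]\<^bsub>GL\<^esub> (j::nat)) *v v = v + l v *s (s *s \<alpha>)) \<and> s * l \<alpha> = (1 + l \<alpha>) ^ j - 1"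
proof (induction j)
  case 0
  show ?case
    by (intro exI[of _ 0]) (simp add: GL_def)
next
  case (Suc j)
  then obtain s where s: "\<And>v. (g [^]\<^bsub>GL\<^esub> j) *v v = v + l v *s (s *s \<alpha>)" "s * l \<alpha> = (1 + l \<alpha>) ^ j - 1"
    by blast
  have "(g [^]\<^bsub>GL\<^esub> Suc j) *v v = v + l v *s ((1 + (1 + l \<alpha>) * s) *s \<alpha>)" for v
  proof -
    have "g [^]\<^bsub>GL\<^esub> Suc j = (g [^]\<^bsub>GL\<^esub> j) ** g"
      by (simp add: GL_def)
    then show ?thesis
      using product_action[OF s(1) g, of v] by (simp add: vec.scale_left_distrib)
  qed
  moreover have "(1 + (1 + l \<alpha>) * s) * l \<alpha> = l \<alpha> + (1 + l \<alpha>) * (s * l \<alpha>)"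
    by (simp add: algebra_simps)
  then have "(1 + (1 + l \<alpha>) * s) * l \<alpha> = (1 + l \<alpha>) ^ Suc j - 1"
    unfolding s(2) by (simp add: algebra_simps)
  ultimately show ?case
    by blast
qed

text \<open>If the root were nonzero, comparing \<open>g *v x\<close> with a multiple of
  \<open>x\<close> for an eigenvector \<open>x\<close> would force \<open>l x = 0\<close>; but
  eigenvectors span the space and \<open>l\<close> is not zero.\<close>

lemma semisimple_transvection:
  assumes "semisimple g" and g: "\<And>v. g *v v = v + l v *s \<alpha>" and "l \<alpha> = 0"
  shows "\<alpha> = 0"
proof (rule ccontr)
  assume "\<alpha> \<noteq> 0"
  obtain P D :: "'p mod_ring ^ 'n ^ 'n" where PD: "invertible P" "\<And>i j. i \<noteq> j \<Longrightarrow> D $ i $ j = 0" "g = P ** D ** matrix_inv P"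
    using assms(1) unfolding semisimple_def by blast
  have "l (P *v axis i 1) = 0" for i
  proof -
    let ?x = "P *v axis i 1"
    have "D *v axis i 1 = D $ i $ i *s axis i 1"
      using PD(2) by (auto simp: vec_eq_iff matrix_vector_mult_def axis_def if_distrib[of "(*) _"] cong: if_cong)
    moreover have "g *v ?x = P *v (D *v ((matrix_inv P ** P) *v axis i 1))"
      by (simp only: PD(3) matrix_vector_mul_assoc matrix_mul_assoc)
    ultimately have "g *v ?x = D $ i $ i *s ?x"
      by (simp add: matrix_inv_mult[OF PD(1)] vec.scale)
    then have eq: "l ?x *s \<alpha> = (D $ i $ i - 1) *s ?x"
      using g[of ?x] by (simp add: vec.scale_left_diff_distrib algebra_simps)
    then have "l (l ?x *s \<alpha>) = l ((D $ i $ i - 1) *s ?x)"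
      by simp
    then have "D $ i $ i = 1 \<or> l ?x = 0"
      using assms(3) by (simp add: l.scale)
    then show ?thesis
      using eq \<open>\<alpha> \<noteq> 0\<close> by auto
  qed
  then have "l (P *v y) = 0" for y
  proof -
    have "y = (\<Sum>i\<in>UNIV. y $ i *s axis i 1)"
      by (simp add: vec_eq_iff axis_def if_distrib[of "(*) _"] cong: if_cong)
    then have "P *v y = (\<Sum>i\<in>UNIV. y $ i *s (P *v axis i 1))"
      by (metis (no_types, lifting) sum.cong vec.scale vec.sum)
    then show ?thesis
      using \<open>\<And>i. l (P *v axis i 1) = 0\<close> by (simp add: l.sum l.scale)
  qed
  moreover have "v = P *v (matrix_inv P *v v)" for v
    by (simp add: matrix_vector_mul_assoc matrix_inv_mult[OF PD(1)])
  ultimately have "l v = 0" for v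
    by metis
  then show False
    using nonzero by simp
qed

text \<open>The root itself is an eigenvector outside the kernel of \<open>l\<close>, and
  \<open>g\<close> fixes the kernel pointwise; so the root completes a basis of the kernel to a
  basis of eigenvectors.\<close>

lemma semisimple_homology:
  assumes g: "\<And>v. g *v v = v + l v *s \<alpha>" and "l \<alpha> \<noteq> 0"
  shows "semisimple g"
proof -
  let ?v0 = "inverse (l \<alpha>) *s \<alpha>"
  have v0: "l ?v0 = 1"
    using assms(2) by (simp add: l.scale)
  \<comment> \<open>With \<open>{0}\<close> as the distinguished subspace,
    \<open>adapted_basis\<close> merely completes \<open>?v0\<close> by some basis of the
    kernel.\<close>
  have "{0} \<subseteq> {v. l v = 0}"
    by (simp add: l.zero)
  then obtain B Q i0 and L :: "'n set" where B: "B ** Q = mat 1" "Q ** B = mat 1" "i0 \<notin> L" "card L = vec.dim {0 :: 'p mod_ring ^ 'n}"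
    and lB: "\<forall>x. l (B *v x) = x $ i0" and Bi0: "B *v axis i0 1 = ?v0"
    and "{0} = (*v) B ` {x. \<forall>i. i \<notin> L \<longrightarrow> x $ i = 0}"
    by (rule adapted_basis[OF linear v0 vec.subspace_single_0])
  have inv: "invertible B"
    using B by (auto simp: invertible_def)
  have "matrix_inv B = matrix_inv B ** (B ** Q)"
    by (simp add: B)
  also have "\<dots> = Q"
    by (simp add: matrix_mul_assoc matrix_inv_mult[OF inv])
  finally have Q: "matrix_inv B = Q" .
  let ?D = "axis_matrix i0 (l \<alpha> *s axis i0 1)"
  have "g = B ** ?D ** Q"
    unfolding matrix_eq
  proof
    fix v
    have BQ: "B *v (Q *v v) = v"
      by (simp add: matrix_vector_mul_assoc B)
    have "(B ** ?D ** Q) *v v = B *v (?D *v (Q *v v))"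
      by (simp only: matrix_vector_mul_assoc matrix_mul_assoc)
    also have "\<dots> = v + (Q *v v) $ i0 *s (l \<alpha> *s ?v0)"
      by (simp only: axis_matrix_mult_vec matrix_vector_right_distrib BQ vec.scale Bi0)
    also have "(Q *v v) $ i0 = l v"
      using lB[rule_format, of "Q *v v"] BQ by simp
    also have "l \<alpha> *s ?v0 = \<alpha>"
      using assms(2) by simp
    finally show "g *v v = (B ** ?D ** Q) *v v"
      using g by simp
  qed
  moreover have "?D $ i $ j = 0" if "i \<noteq> j" for i j
    using that by (auto simp: axis_matrix_def axis_def)
  ultimately show ?thesis
    unfolding semisimple_def using inv Q by blast
qed

text \<open>A power of \<open>g\<close> is trivial when the multiple \<open>s *s \<alpha>\<close>
  that is its root vanishes. If \<open>l \<alpha> = 0\<close>, semisimplicity leaves only the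
  identity; otherwise \<open>s\<close> vanishes together with \<open>s * l \<alpha>\<close>.\<close>

lemma ord_semisimple:
  assumes "g \<in> G" "semisimple g" and g: "\<And>v. g *v v = v + l v *s \<alpha>"
  shows "GL.ord g dvd j \<longleftrightarrow> (1 + l \<alpha>) ^ j = 1"
proof -
  have "GL.ord g dvd j \<longleftrightarrow> g [^]\<^bsub>GL\<^esub> j = mat 1"
    using GL.pow_eq_id[OF subgroup.mem_carrier[OF subgroup assms(1)], of j] by (simp add: GL_def)
  also obtain s where s: "\<And>v. (g [^]\<^bsub>GL\<^esub> j) *v v = v + l v *s (s *s \<alpha>)" "s * l \<alpha> = (1 + l \<alpha>) ^ j - 1"
    using nat_pow_action[OF g] by blast
  have "g [^]\<^bsub>GL\<^esub> j = mat 1 \<longleftrightarrow> (\<forall>v. l v *s (s *s \<alpha>) = 0)"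
    by (simp add: matrix_eq s(1))
  also have "\<dots> \<longleftrightarrow> s *s \<alpha> = 0"
    using ex_l_eq_1 by (metis vec.scale_one vec.scale_zero_right)
  also have "\<dots> \<longleftrightarrow> (1 + l \<alpha>) ^ j = 1"
  proof (cases "l \<alpha> = 0")
    case True
    then show ?thesis
      using semisimple_transvection[OF assms(2) g] by simp
  next
    case False
    then have "\<alpha> \<noteq> 0"
      using l.zero by auto
    then show ?thesis
      using s(2) False by (metis eq_iff_diff_eq_0 mult_eq_0_iff vec.scale_eq_0_iff)
  qed
  finally show ?thesis .
qed

text \<open>The order of \<open>u\<close> is attained by a semisimple element with factor
  \<open>u\<close>. The factor of any other semisimple element is a power of \<open>u\<close>, so
  its order divides this one.\<close>

lemma max_semisimple_order:
  assumes u: "u \<in> U" "U = range (\<lambda>k::nat. u ^ k)"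
  shows "u ^ j = 1 \<longleftrightarrow> max_semisimple_order G dvd j"
proof -
  have "\<exists>g\<in>G. \<exists>\<alpha>. (\<forall>v. g *v v = v + l v *s \<alpha>) \<and> semisimple g \<and> 1 + l \<alpha> = u"
  \<comment> \<open>For \<open>u = 1\<close> the identity is taken, since another element with this
    factor would be a transvection, which is not semisimple.\<close>
  proof (cases "u = 1")
    case True
    let ?I = "mat 1 :: 'p mod_ring ^ 'n ^ 'n"
    have off: "\<forall>i j. i \<noteq> j \<longrightarrow> ?I $ i $ j = 0"
      by (simp add: mat_def)
    have "invertible ?I"
      unfolding invertible_def by (rule exI[of _ ?I]) simp
    moreover from matrix_inv_mult_right[OF this] have "matrix_inv ?I = ?I"
      by simp
    ultimately have "semisimple ?I"
      unfolding semisimple_def using off by (intro exI[of _ ?I]) simp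
    moreover have "mat 1 \<in> G"
      using subgroup.one_closed[OF subgroup] by (simp add: GL_def)
    ultimately show ?thesis
      using True by (intro bexI[of _ "mat 1"] exI[of _ 0]) (simp_all add: l.zero)
  next
    case False
    obtain \<alpha> where \<alpha>: "\<alpha> \<in> root_space l G" "u = 1 + l \<alpha>"
      using u(1) by (auto simp: U_def)
    obtain g where g: "g \<in> G" "\<And>v. g *v v = v + l v *s \<alpha>"
      using rootE[OF \<alpha>(1)] by blast
    have "semisimple g"
      using semisimple_homology[OF g(2)] False \<alpha>(2) by simp
    then show ?thesis
      using g \<alpha>(2) by blast
  qed
  then obtain g0 where g0: "g0 \<in> G" "semisimple g0" and ord0: "\<And>j. GL.ord g0 dvd j \<longleftrightarrow> u ^ j = 1"
    using ord_semisimple by blast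
  have "u \<noteq> 0"
    using u(1) U_nonzero by auto
  then have "u ^ (CARD('p) - 1) = 1"
    using finite_field_power_card_power_minus_1[of u 1] by simp
  then have "GL.ord g0 dvd CARD('p) - 1"
    by (simp add: ord0)
  then have pos: "0 < GL.ord g0"
    using prime_gt_1_nat[OF prime_card[where ?'a = 'p]] by (auto intro: Nat.gr0I)
  have "max_semisimple_order G = GL.ord g0"
    unfolding max_semisimple_order_def
  proof (rule Max_eqI)
    show "finite {GL.ord g |g. g \<in> G \<and> semisimple g}"
      by (simp add: finite_image_set)
    show "GL.ord g0 \<in> {GL.ord g |g. g \<in> G \<and> semisimple g}"
      using g0 by blast
    fix r assume "r \<in> {GL.ord g |g. g \<in> G \<and> semisimple g}"
    then obtain g where g: "r = GL.ord g" "g \<in> G" "semisimple g"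
      by blast
    obtain \<alpha> where \<alpha>: "\<alpha> \<in> root_space l G" "\<And>v. g *v v = v + l v *s \<alpha>"
      using ex_root[OF g(2)] by blast
    then have "1 + l \<alpha> \<in> range (\<lambda>k::nat. u ^ k)"
      using u(2) by (auto simp: U_def)
    then obtain k where "1 + l \<alpha> = u ^ k"
      by blast
    then have "(1 + l \<alpha>) ^ GL.ord g0 = (u ^ GL.ord g0) ^ k"
      by (simp add: mult.commute flip: power_mult)
    also have "u ^ GL.ord g0 = 1"
      by (simp flip: ord0)
    finally have "r dvd GL.ord g0"
      by (simp add: g(1) ord_semisimple[OF g(2,3) \<alpha>(2)])
    then show "r \<le> GL.ord g0"
      using pos by (rule dvd_imp_le)
  qed
  then show ?thesis
    by (simp add: ord0)
qed

section \<open>Splitting of the root space and the normal form\<close>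

text \<open>This is a semidirect product seen on roots: the powers of one element with root along
  \<open>v0\<close> realise every factor in \<open>U\<close>, and composing with the inverse of a
  suitable power moves any root into \<open>W\<close>, up to a nonzero scalar.\<close>

lemma root_space_decomposition:
  assumes u: "u \<in> U" "U = range (\<lambda>k::nat. u ^ k)"
  obtains v0 where "l v0 = 1" "root_space l G = {w + s *s v0 | w s. w \<in> W \<and> 1 + s \<in> U}"
proof -
  obtain v0 where v0: "l v0 = 1" "(u - 1) *s v0 \<in> root_space l G"
  proof (cases "u = 1")
    case True
    then show thesis
      using that ex_l_eq_1 root_0 by auto
  next
    case False
    obtain \<alpha> where \<alpha>: "\<alpha> \<in> root_space l G" "u = 1 + l \<alpha>"
      using u(1) by (auto simp: U_def)
    then show thesis
      \<comment> \<open>As \<open>u - 1 = l \<alpha>\<close>, the vector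
        \<open>(u - 1) *s v0\<close> is the root \<open>\<alpha>\<close> itself.\<close>
      using that[of "inverse (l \<alpha>) *s \<alpha>"] False by (simp add: l.scale)
  qed
  have pow: "(u ^ k - 1) *s v0 \<in> root_space l G" for k :: nat
  proof (induction k)
    case (Suc k)
    have "(u ^ k - 1) *s v0 + (1 + l ((u ^ k - 1) *s v0)) *s ((u - 1) *s v0) =
        (u ^ k - 1 + u ^ k * (u - 1)) *s v0"
      by (simp only: l.scale v0(1) vec.scale_scale vec.scale_left_distrib) simp
    also have "u ^ k - 1 + u ^ k * (u - 1) = u ^ Suc k - 1"
      by (simp add: algebra_simps)
    finally have "(u ^ k - 1) *s v0 + (1 + l ((u ^ k - 1) *s v0)) *s ((u - 1) *s v0) = (u ^ Suc k - 1) *s v0" .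
    then show ?case
      using root_mult[OF v0(2) Suc] by simp
  qed (simp add: root_0)
  have sv0: "s *s v0 \<in> root_space l G" if s: "1 + s \<in> U" for s
  proof -
    obtain k where "1 + s = u ^ k"
      using s u(2) by auto
    then have "s = u ^ k - 1"
      by (simp add: algebra_simps)
    then show ?thesis
      using pow by simp
  qed
  have "root_space l G = {w + s *s v0 | w s. w \<in> W \<and> 1 + s \<in> U}"
  proof (intro equalityI subsetI)
    fix \<alpha> assume \<alpha>: "\<alpha> \<in> root_space l G"
    let ?\<beta> = "l \<alpha> *s v0"
    have s: "1 + l \<alpha> \<in> U"
      using \<alpha> by (simp add: U_def)
    obtain \<beta>' where \<beta>': "\<beta>' \<in> root_space l G" "\<beta>' = - ((1 + l \<beta>') *s ?\<beta>)" "(1 + l \<beta>') * (1 + l ?\<beta>) = 1"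
      using root_inverse[OF sv0[OF s]] by blast
    have "\<beta>' + (1 + l \<beta>') *s \<alpha> = (1 + l \<beta>') *s (\<alpha> - ?\<beta>)"
      by (subst \<beta>'(2)) (simp add: vec.scale_right_diff_distrib)
    with root_mult[OF \<alpha> \<beta>'(1)] have "(1 + l \<beta>') *s (\<alpha> - ?\<beta>) \<in> W"
      by (simp add: W_def l.scale l.diff v0)
    then have "inverse (1 + l \<beta>') *s ((1 + l \<beta>') *s (\<alpha> - ?\<beta>)) \<in> W"
      by (rule vec.subspace_scale[OF subspace_W])
    moreover have "1 + l \<beta>' \<noteq> 0"
      using \<beta>'(3) by auto
    ultimately have "\<alpha> - ?\<beta> \<in> W"
      by simp
    with s show "\<alpha> \<in> {w + s *s v0 | w s. w \<in> W \<and> 1 + s \<in> U}"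
      by (intro CollectI exI[of _ "\<alpha> - ?\<beta>"] exI[of _ "l \<alpha>"]) simp
  next
    fix \<alpha> assume "\<alpha> \<in> {w + s *s v0 | w s. w \<in> W \<and> 1 + s \<in> U}"
    then obtain w s where \<alpha>: "\<alpha> = w + s *s v0" "w \<in> W" "1 + s \<in> U"
      by blast
    then have "1 + s \<noteq> 0"
      using U_nonzero by metis
    \<comment> \<open>The composition law will multiply this root by \<open>1 + s\<close>; the
      inverse factor compensates in advance.\<close>
    have "inverse (1 + s) *s w \<in> root_space l G"
      using vec.subspace_scale[OF subspace_W \<alpha>(2)] by (auto simp: W_def)
    from root_mult[OF this sv0[OF \<alpha>(3)]] show "\<alpha> \<in> root_space l G"
      using \<open>1 + s \<noteq> 0\<close> by (simp add: \<alpha>(1) l.scale v0 add.commute)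
  qed
  then show thesis
    using that v0(1) by blast
qed

lemma matrix_inv_image: "matrix_inv ` G = G"
proof -
  have inv: "matrix_inv g = inv\<^bsub>GL\<^esub> g" if "g \<in> G" for g
  proof (rule GL.inv_equality[symmetric])
    have g: "invertible g"
      using subgroup.mem_carrier[OF subgroup that] by (simp add: GL_def)
    then show "matrix_inv g \<otimes>\<^bsub>GL\<^esub> g = \<one>\<^bsub>GL\<^esub>" "g \<in> carrier GL" "matrix_inv g \<in> carrier GL"
      using matrix_inv_mult[OF g] by (auto simp: GL_def invertible_def)
  qed
  have "g \<in> matrix_inv ` G" if "g \<in> G" for g
    using inv[OF subgroup.m_inv_closed[OF subgroup that]] subgroup.m_inv_closed[OF subgroup that]
      GL.inv_inv[OF subgroup.mem_carrier[OF subgroup that]] by (metis imageI)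
  then show ?thesis
    using inv subgroup.m_inv_closed[OF subgroup] by auto
qed

text \<open>In an adapted basis the element with root \<open>\<alpha>\<close> becomes
  \<open>axis_matrix i0 (Q *v \<alpha>)\<close>, so the splitting of the root space is exactly the
  condition on \<open>c\<close> in \<open>normal_form\<close>. Inversion only permutes
  \<open>G\<close>.\<close>

theorem normal_form:
  obtains B Q :: "'p mod_ring ^ 'n ^ 'n" and i0 L and u :: "'p mod_ring" where
    "B ** Q = mat 1" "Q ** B = mat 1" "i0 \<notin> L" "card L = vec.dim (root_space l G \<inter> {v. l v = 0})"
    "u \<noteq> 0" "\<And>j. u ^ j = 1 \<longleftrightarrow> max_semisimple_order G dvd j"
    "(\<lambda>A. Q ** A ** B) ` matrix_inv ` G = normal_form i0 L (range (\<lambda>k::nat. u ^ k))"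
proof -
  obtain u where u: "u \<in> U" "U = range (\<lambda>k::nat. u ^ k)"
    using U_cyclic by blast
  obtain v0 where v0: "l v0 = 1" and R: "root_space l G = {w + s *s v0 | w s. w \<in> W \<and> 1 + s \<in> U}"
    using root_space_decomposition[OF u] by blast
  have "W \<subseteq> {v. l v = 0}"
    by (auto simp: W_def)
  then obtain B Q :: "'p mod_ring ^ 'n ^ 'n" and i0 L where B: "B ** Q = mat 1" "Q ** B = mat 1" "i0 \<notin> L" "card L = vec.dim W"
    and lB: "\<forall>x. l (B *v x) = x $ i0" and Bi0: "B *v axis i0 1 = v0"
    and WB: "W = (*v) B ` {x. \<forall>i. i \<notin> L \<longrightarrow> x $ i = 0}"
    by (rule adapted_basis[OF linear v0 subspace_W])
  have BQ: "B *v (Q *v v) = v" "Q *v (B *v v) = v" for v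
    by (simp_all add: matrix_vector_mul_assoc B)
  have conj: "Q ** g ** B = axis_matrix i0 (Q *v \<alpha>)" if "\<And>v. g *v v = v + l v *s \<alpha>" for g \<alpha>
    unfolding matrix_eq
  proof
    fix x
    have "(Q ** g ** B) *v x = Q *v (g *v (B *v x))"
      by (simp only: matrix_vector_mul_assoc matrix_mul_assoc)
    also have "\<dots> = x + x $ i0 *s (Q *v \<alpha>)"
      by (simp add: that matrix_vector_right_distrib BQ lB vec.scale)
    finally show "(Q ** g ** B) *v x = axis_matrix i0 (Q *v \<alpha>) *v x"
      by (simp add: axis_matrix_mult_vec)
  qed
  have "(\<lambda>A. Q ** A ** B) ` G = (\<lambda>\<alpha>. axis_matrix i0 (Q *v \<alpha>)) ` root_space l G"
  proof (intro equalityI subsetI)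
    fix A assume "A \<in> (\<lambda>A. Q ** A ** B) ` G"
    then obtain g where "g \<in> G" "A = Q ** g ** B"
      by blast
    moreover from \<open>g \<in> G\<close> obtain \<alpha> where "\<alpha> \<in> root_space l G" "\<And>v. g *v v = v + l v *s \<alpha>"
      using ex_root by blast
    ultimately show "A \<in> (\<lambda>\<alpha>. axis_matrix i0 (Q *v \<alpha>)) ` root_space l G"
      using conj by blast
  next
    fix A assume "A \<in> (\<lambda>\<alpha>. axis_matrix i0 (Q *v \<alpha>)) ` root_space l G"
    then obtain \<alpha> where "\<alpha> \<in> root_space l G" "A = axis_matrix i0 (Q *v \<alpha>)"
      by blast
    moreover from this obtain g where "g \<in> G" "\<And>v. g *v v = v + l v *s \<alpha>"
      using rootE by blast
    ultimately show "A \<in> (\<lambda>A. Q ** A ** B) ` G"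
      using conj by (metis imageI)
  qed
  also have "\<dots> = axis_matrix i0 ` (*v) Q ` root_space l G"
    by (simp add: image_image)
  also have "(*v) Q ` root_space l G = {c. (\<forall>i. i \<notin> insert i0 L \<longrightarrow> c $ i = 0) \<and> 1 + c $ i0 \<in> U}"
  proof (intro equalityI subsetI)
    fix c assume "c \<in> (*v) Q ` root_space l G"
    then obtain x s where x: "\<And>i. i \<notin> L \<Longrightarrow> x $ i = 0" "1 + s \<in> U" "c = Q *v (B *v x + s *s v0)"
      unfolding R WB by blast
    then have "c = x + s *s axis i0 1"
      by (simp add: matrix_vector_right_distrib BQ vec.scale flip: Bi0)
    then show "c \<in> {c. (\<forall>i. i \<notin> insert i0 L \<longrightarrow> c $ i = 0) \<and> 1 + c $ i0 \<in> U}"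
      using x(1,2) B(3) by (auto simp: axis_def)
  next
    fix c assume c: "c \<in> {c. (\<forall>i. i \<notin> insert i0 L \<longrightarrow> c $ i = 0) \<and> 1 + c $ i0 \<in> U}"
    let ?x = "\<chi> i. if i \<in> L then c $ i else 0"
    have "c = ?x + c $ i0 *s axis i0 1"
      using c B(3) by (auto simp: vec_eq_iff axis_def)
    then have "B *v c = B *v ?x + c $ i0 *s v0"
      by (metis Bi0 matrix_vector_right_distrib vec.scale)
    moreover have "B *v ?x \<in> W"
      unfolding WB by (rule imageI) simp
    ultimately have "B *v c \<in> root_space l G"
      unfolding R using c by blast
    then show "c \<in> (*v) Q ` root_space l G"
      by (rule rev_image_eqI) (simp add: BQ)
  qed
  finally have "(\<lambda>A. Q ** A ** B) ` matrix_inv ` G = normal_form i0 L (range (\<lambda>k. u ^ k))"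
    unfolding matrix_inv_image normal_form_def by (simp flip: u(2))
  moreover have "u \<noteq> 0"
    using u(1) U_nonzero by auto
  ultimately show thesis
    using that B max_semisimple_order[OF u] by (simp flip: W_def)
qed

end

section \<open>The Hilbert series\<close>

lemma fps_nth_eq_0_if_X_power_dvd:
  assumes "fps_X ^ k dvd (f :: rat fps)" "d < k"
  shows "fps_nth f d = 0"
  using assms by (auto simp: fps_X_power_mult_nth elim!: dvdE)

theorem theorem8p1:
  fixes G :: "('p::prime_card mod_ring ^ 'n ^ 'n) set"
    and H :: "('p mod_ring ^ 'n) set"
    and l :: "'p mod_ring ^ 'n \<Rightarrow> 'p mod_ring"
    and p n m \<l> e :: nat
    and t :: "rat fps"
  assumes "p = CARD('p)" and "n = CARD('n)" and "m \<ge> 1" and "t = fps_X"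
    and "subgroup G GL"
    and "vec.subspace H" and "vec.dim H = n - 1"
    and "\<forall>g \<in> G. \<forall>v \<in> H. g *v v = v"
    and "Vector_Spaces.linear (*s) (*) l" and "{v. l v = 0} = H"
    and "\<l> = vec.dim (root_space l G \<inter> H)"
    and "e = max_semisimple_order G"
  shows "Hilb_quot_invariants G (power_ideal (p ^ m)) =
           ((1 - t ^ p ^ m) / (1 - t)) ^ (n - \<l> - 1) * ((1 - t ^ p ^ m) / (1 - t ^ p)) ^ \<l> *
           ((1 - t ^ (p ^ m - 1)) / (1 - t ^ e) + t ^ (p ^ m - 1) * ((1 - t ^ p) / (1 - t)) ^ \<l>) \<and>
         Hilb_quot_invariants G (power_ideal (p ^ m)) =
           ((1 - t ^ p ^ m) / (1 - t)) ^ (n - \<l> - 1) * ((1 - t ^ p ^ m) / (1 - t ^ p)) ^ \<l> *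
           ((1 - t ^ (p ^ m - 1)) / (1 - t ^ e)) +
           t ^ (p ^ m - 1) * ((1 - t ^ p ^ m) / (1 - t)) ^ (n - 1) \<and>
         Hilb_quot_invariants G (power_ideal (p ^ m)) =
           Hilb_invariants G * (1 - t ^ p ^ m) ^ (n - 1) *
           ((1 - t ^ (p ^ m - 1)) +
            t ^ (p ^ m - 1) * (1 - t ^ e) * ((1 - t ^ p) / (1 - t)) ^ \<l>)"
proof -
  have prime: "prime p"
    unfolding assms(1) by (rule prime_card)
  have "0 < n"
    by (simp add: assms(2))
  have "\<exists>v. l v \<noteq> 0"
  proof (rule ccontr)
    assume "\<not> (\<exists>v. l v \<noteq> 0)"
    then have "H = UNIV"
      using assms(10) by auto
    then have "n = n - 1"
      using assms(7) unfolding assms(2) by (simp only: vec_dim_card)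
    with \<open>0 < n\<close> show False
      by linarith
  qed
  then interpret hyperplane_group G l
    using assms(5,8,9,10) by (intro hyperplane_group.intro) auto
  obtain B Q :: "'p mod_ring ^ 'n ^ 'n" and i0 L and u :: "'p mod_ring" where
    BQ: "B ** Q = mat 1" "Q ** B = mat 1" and i0: "i0 \<notin> L"
    and L: "card L = vec.dim (root_space l G \<inter> {v. l v = 0})"
    and u: "u \<noteq> 0" and ue: "\<And>j. u ^ j = 1 \<longleftrightarrow> max_semisimple_order G dvd j"
    and nf: "(\<lambda>A. Q ** A ** B) ` matrix_inv ` G = normal_form i0 L (range (\<lambda>k::nat. u ^ k))"
    using normal_form by blast
  have L: "card L = \<l>"
    using L assms(10,11) by simp
  have ue: "u ^ j = 1 \<longleftrightarrow> e dvd j" for j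
    using ue assms(12) by simp
  have inv: "invertible g" if "g \<in> G" for g
    using subgroup.mem_carrier[OF subgroup that] by (simp add: GL_def)
  define N where "N m d = card (leading_exponents i0 L p e (p ^ m) d)" for m d
  have card: "card ((+>\<^bsub>mpol_ring\<^esub>) (power_ideal (p ^ m)) ` invariants_mod (matrix_inv ` G) (p ^ m) d) =
      CARD('p mod_ring) ^ N m d" for m d
  proof -
    have "card ((+>\<^bsub>mpol_ring\<^esub>) (power_ideal (p ^ m)) ` invariants_mod (matrix_inv ` G) (p ^ m) d) =
        card ((+>\<^bsub>mpol_ring\<^esub>) (power_ideal (p ^ m)) `
          invariants_mod (normal_form i0 L (range (\<lambda>k::nat. u ^ k))) (p ^ m) d)"
      unfolding nf[symmetric] by (rule card_cosets_conjugate[OF _ _ BQ(2,1), of _ m]) (use prime assms(1) in simp_all)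
    also have "\<dots> = CARD('p) ^ N m d"
      unfolding N_def assms(1) by (rule card_normal_form_invariants[OF i0 refl ue refl u])
    finally show ?thesis
      by simp
  qed
  have quot: "Hilb_quot_invariants G (power_ideal (p ^ m)) = Abs_fps (\<lambda>d. of_nat (N m d))" for m
    unfolding Hilb_quot_invariants_def hilbert_series_def
    using dim_quot_invariants_eq[OF _ _ inv card, of m] prime assms(1) by simp
  \<comment> \<open>The exponent may vary with the degree: the component of degree \<open>d\<close>
    can be read off any quotient whose ideal begins above \<open>d\<close>.\<close>
  have invs: "Hilb_invariants G = Abs_fps (\<lambda>d. of_nat (N (m d) d))" if "\<And>d. d < p ^ m d" for m
    unfolding Hilb_invariants_def hilbert_series_def
    using dim_invariants_eq[OF that card] by simp
  have edvd: "e dvd p ^ m - 1" for m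
    using finite_field_power_card_power_minus_1[OF u, of m] by (simp add: assms(1) ue)
  have "e dvd p - 1" "0 < p - 1"
    using edvd[of 1] prime_gt_1_nat[OF prime] by simp_all
  then have e: "0 < e"
    by (metis dvd_0_left_iff gr0I less_numeral_extra(3))
  have p: "0 < p"
    using prime by (rule prime_gt_0_nat)
  define k where "k = n - \<l> - 1"
  \<comment> \<open>The index \<open>i0\<close> is outside \<open>L\<close>, so the subtraction in
    \<open>n - \<l> - 1\<close> is not truncated.\<close>
  have "card (insert i0 L) \<le> n"
    unfolding assms(2) by (rule card_mono) auto
  then have n: "n - 1 = k + \<l>"
    using i0 L by (simp add: k_def)
  define a where "a = inverse (1 - t)"
  define b where "b = inverse (1 - t ^ p)"
  define c where "c = inverse (1 - t ^ e)"
  have unit: "fps_nth (1 - t ^ r) 0 \<noteq> 0" if "0 < r" for r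
    using that by (simp add: assms(4))
  have bp: "b * (1 - t ^ p) = 1" and ce: "c * (1 - t ^ e) = 1"
    using unit p e by (simp_all add: b_def c_def inverse_mult_eq_1)
  \<comment> \<open>All denominators have constant term 1, so quotients become products with
    inverses and the rest is commutative algebra in \<open>a\<close>, \<open>b\<close>,
    \<open>c\<close> and \<open>t\<close>.\<close>
  have div: "f / (1 - t) = f * a" "f / (1 - t ^ p) = f * b" "f / (1 - t ^ e) = f * c" for f
    using unit[of 1] unit[of p] unit[of e] p e by (simp_all add: fps_divide_unit a_def b_def c_def)
  have series: "Abs_fps (\<lambda>d. of_nat (N m d)) =
      ((1 - t ^ p ^ m) * a) ^ k * ((1 - t ^ p ^ m) * b) ^ \<l> * ((1 - t ^ (p ^ m - 1)) * c) +
      t ^ (p ^ m - 1) * ((1 - t ^ p ^ m) * a) ^ (k + \<l>)" if "0 < m" for m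
    using leading_exponents_series[OF i0 p that refl e edvd assms(4)]
    unfolding N_def L assms(2)[symmetric] div k_def[symmetric] n .
  have Hilb: "Hilb_invariants G = a ^ k * b ^ \<l> * c"
  proof (rule fps_ext)
    fix d
    \<comment> \<open>The choice guarantees \<open>d + 1 < p ^ M d\<close>: the quotient series can
      deviate from its limit from degree \<open>p ^ M d - 1\<close> on, one degree before the ideal
      begins.\<close>
    define M where "M d = d + 2" for d :: nat
    have M: "d + 1 < p ^ M d" for d
    proof -
      have "d + 2 < 2 ^ (d + 2)"
        by (rule less_exp)
      also have "\<dots> \<le> p ^ M d"
        unfolding M_def using prime_ge_2_nat[OF prime] by (rule power_mono) simp
      finally show ?thesis
        by simp
    qed
    let ?q = "p ^ M d"
    let ?r = "?q - 1"
    have "?q = Suc ?r"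
      using M[of d] by linarith
    then have q: "t ^ ?q = t ^ ?r * t"
      by (metis power_Suc2)
    have "(1 - t ^ ?q) - 1 dvd (1 - t ^ ?q) ^ (k + \<l>) - 1 ^ (k + \<l>)"
      by (simp only: power_diff_sumr2 dvd_triv_left)
    then have "t ^ ?r dvd (1 - t ^ ?q) ^ (k + \<l>) - 1"
      unfolding q by (auto intro: dvd_mult_left)
    \<comment> \<open>The closed form of the series minus its limit, regrouped so that each summand
      is visibly a multiple of \<open>t ^ ?r\<close>.\<close>
    then have "t ^ ?r dvd a ^ k * b ^ \<l> * c * ((1 - t ^ ?q) ^ (k + \<l>) - 1) +
        t ^ ?r * (((1 - t ^ ?q) * a) ^ (k + \<l>) - a ^ k * b ^ \<l> * c * (1 - t ^ ?q) ^ (k + \<l>))"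
      by (intro dvd_add dvd_mult dvd_triv_left)
    also have "\<dots> = Abs_fps (\<lambda>d'. of_nat (N (M d) d')) - a ^ k * b ^ \<l> * c"
    proof -
      have "a ^ k * b ^ \<l> * c * (x ^ (k + \<l>) - 1) + y * ((x * a) ^ (k + \<l>) - a ^ k * b ^ \<l> * c * x ^ (k + \<l>)) =
          (x * a) ^ k * (x * b) ^ \<l> * ((1 - y) * c) + y * (x * a) ^ (k + \<l>) - a ^ k * b ^ \<l> * c" for x y
        by (simp add: power_add power_mult_distrib algebra_simps)
      moreover have "0 < M d"
        by (simp add: M_def)
      ultimately show ?thesis
        by (simp only: series)
    qed
    finally have "fps_nth (Abs_fps (\<lambda>d'. of_nat (N (M d) d')) - a ^ k * b ^ \<l> * c) d = 0"
      using M[of d] by (intro fps_nth_eq_0_if_X_power_dvd[of ?r]) (simp_all add: assms(4))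
    moreover have "fps_nth (Hilb_invariants G) d = of_nat (N (M d) d)"
      using M by (subst invs[of M]) (auto intro: Suc_lessD)
    ultimately show "fps_nth (Hilb_invariants G) d = fps_nth (a ^ k * b ^ \<l> * c) d"
      by simp
  qed
  let ?q = "p ^ m"
  have 2: "Hilb_quot_invariants G (power_ideal ?q) =
      ((1 - t ^ ?q) * a) ^ k * ((1 - t ^ ?q) * b) ^ \<l> * ((1 - t ^ (?q - 1)) * c) +
      t ^ (?q - 1) * ((1 - t ^ ?q) * a) ^ (k + \<l>)"
    using quot series assms(3) by simp
  have bl: "b ^ \<l> * (1 - t ^ p) ^ \<l> = 1"
    by (simp add: bp flip: power_mult_distrib)
  \<comment> \<open>The factors \<open>1 - t ^ p\<close> cancel \<open>b\<close>, which turns the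
    factors of the variables in \<open>L\<close> into those of free variables and links the first
    two forms.\<close>
  have "((1 - t ^ ?q) * b) ^ \<l> * ((1 - t ^ p) * a) ^ \<l> = (b ^ \<l> * (1 - t ^ p) ^ \<l>) * ((1 - t ^ ?q) * a) ^ \<l>"
    by (simp only: power_mult_distrib ac_simps)
  then have swap: "((1 - t ^ ?q) * b) ^ \<l> * ((1 - t ^ p) * a) ^ \<l> = ((1 - t ^ ?q) * a) ^ \<l>"
    by (simp only: bl mult_1)
  have 1: "Hilb_quot_invariants G (power_ideal ?q) =
      ((1 - t ^ ?q) * a) ^ k * ((1 - t ^ ?q) * b) ^ \<l> *
      ((1 - t ^ (?q - 1)) * c + t ^ (?q - 1) * ((1 - t ^ p) * a) ^ \<l>)"
  proof -
    have "((1 - t ^ ?q) * a) ^ k * ((1 - t ^ ?q) * b) ^ \<l> * (t ^ (?q - 1) * ((1 - t ^ p) * a) ^ \<l>) =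
        t ^ (?q - 1) * (((1 - t ^ ?q) * a) ^ k * (((1 - t ^ ?q) * b) ^ \<l> * ((1 - t ^ p) * a) ^ \<l>))"
      by (simp only: ac_simps)
    then show ?thesis
      unfolding 2 distrib_left swap power_add by (simp only:)
  qed
  have 3: "Hilb_quot_invariants G (power_ideal ?q) =
      Hilb_invariants G * (1 - t ^ ?q) ^ (k + \<l>) *
      ((1 - t ^ (?q - 1)) + t ^ (?q - 1) * (1 - t ^ e) * ((1 - t ^ p) * a) ^ \<l>)"
  proof -
    have "a ^ k * b ^ \<l> * c * (1 - t ^ ?q) ^ (k + \<l>) * (t ^ (?q - 1) * (1 - t ^ e) * ((1 - t ^ p) * a) ^ \<l>) =
        t ^ (?q - 1) * ((c * (1 - t ^ e)) * (b ^ \<l> * (1 - t ^ p) ^ \<l>) * ((1 - t ^ ?q) * a) ^ (k + \<l>))"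
      by (simp only: power_mult_distrib power_add ac_simps)
    also have "\<dots> = t ^ (?q - 1) * ((1 - t ^ ?q) * a) ^ (k + \<l>)"
      by (simp only: ce bl mult_1)
    finally have "a ^ k * b ^ \<l> * c * (1 - t ^ ?q) ^ (k + \<l>) *
        (t ^ (?q - 1) * (1 - t ^ e) * ((1 - t ^ p) * a) ^ \<l>) =
        t ^ (?q - 1) * ((1 - t ^ ?q) * a) ^ (k + \<l>)" .
    moreover have "a ^ k * b ^ \<l> * c * (1 - t ^ ?q) ^ (k + \<l>) * (1 - t ^ (?q - 1)) =
        ((1 - t ^ ?q) * a) ^ k * ((1 - t ^ ?q) * b) ^ \<l> * ((1 - t ^ (?q - 1)) * c)"
      by (simp only: power_mult_distrib power_add ac_simps)
    ultimately show ?thesis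
      unfolding 2 Hilb distrib_left by (simp only:)
  qed
  show ?thesis
    unfolding div k_def[symmetric] n using 1 2 3 by blast
qed

end
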